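(* Let $(X,\mathcal A,\mu,T)$ be a conservative ergodic infinite measure preserving system (as in the context) satisfying properties (P1) and (P2) stated in the context. If $N$ is a free $T$-point process with moments of all orders defined on an ergodic system $(\Omega,\mathscr F,\mathbb P,S)$, then $N$ is a Poisson point process (of intensity $A\mapsto\mathbb E[N(A)]$).
   Context: Setting. $X$ is a complete separable metric space with Borel $\sigma$-algebra $\mathcal A$; $\mu$ is a measure on $(X,\mathcal A)$ that is boundedly finite (finite on bounded Borel sets), with $\mu(X)=\infty$; $T:X\to X$ is invertible and preserves $\mu$, and $(X,\mathcal A,\mu,T)$ is conservative and ergodic. Put $\mathcal A_f=\{A\in\mathcal A: 0<\mu(A)<\infty\}$. $X^*$ is the set of boundedly finite simple counting measures $\xi=\sum_{i\in I}\delta_{x_i}$ ($I$ at most countable, $x_i\ne x_j$ for $i\neq j$), identified with the corresponding sets of points, and $\mathcal A^*$ is the $\sigma$-algebra on $X^*$ generated by the maps $\xi\mapsto \xi(A)$, $A$ bounded Borel. $T$-point process. $(\Omega,\mathscr F,\mathbb P)$ is a probability space and $S$ an invertible measure preserving transformation of it. A $T$-point process defined on $(\Omega,\mathscr F,\mathbb P,S)$ is a measurable map $N:\Omega\to X^*$ such that (i) for each $A\in\mathcal A$ with $\mu(A)=0$, $N(\omega)(A)=0$ for $\mathbb P$-a.e. $\omega$; (ii) for $\mathbb P$-a.e. $\omega$, for all $A\in\mathcal A$, $N(S\omega)(A)=N(\omega)(T^{-1}A)$. It has moments of all orders if $\mathbb E[N(A)^n]<\infty$ for all $n\ge1$ and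 $A\in\mathcal A_f$. It is free if for $\mathbb P$-a.e. $\omega$, for all $k\in\mathbb Z\setminus\{0\}$, $N(\omega)\cap N(S^k\omega)=\emptyset$ (as sets of points). Poisson. $N$ is a Poisson point process of intensity $\alpha\mu$ if for all $k\ge 1$ and mutually disjoint $A_1,\dots,A_k\in\mathcal A_f$, the variables $N(A_1),\dots,N(A_k)$ are independent and Poisson distributed with parameters $\alpha\mu(A_1),\dots,\alpha\mu(A_k)$ (the process $N=0$ being Poisson of intensity $0$). Properties (P1), (P2). For $n\ge1$, let $\mathscr P_n$ be the set of partitions of $\{1,\dots,n\}$. For $\pi\in\mathscr P_n$ and $\kappa=(k_i)_{1\le i\le n}$ a family of integers, $m_\pi^\kappa$ is the measure on $X^n$ with $m_\pi^\kappa(A_1\times\cdots\times A_n)=\prod_{P\in\pi}\mu\left(\bigcap_{i\in P}T^{-k_i}A_i\right)$. $\kappa$ is $\pi$-compatible if $k_i=0$ whenever $i$ is the smallest element of an atom of $\pi$. (P1): for each $n\ge1$, the product system $(X^n,\mathcal A^{\otimes n},\mu^{\otimes n},T^{\times n})$ is ergodic. (P2): for each $n\ge1$, if $\sigma$ is a boundedly finite, $T^{\times n}$-invariant measure on $X^n$ whose marginals are absolutely continuous with respect to $\mu$, then $\sigma$ is conservative and its ergodic components are all (up to positive multiplicative constants) of the form $m_\pi^\kappa$ for some $\pi\in\mathscr P_n$ and some $\pi$-compatible family $\kappa$. *)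

theory Defs
  imports "HOL-Probability.Probability"
begin

section \<open>Measure preserving systems\<close>

definition invertible_mpt :: "'a measure \<Rightarrow> ('a \<Rightarrow> 'a) \<Rightarrow> bool" where
  "invertible_mpt M T \<longleftrightarrow>
     T \<in> measurable M M \<and> bij_betw T (space M) (space M) \<and>
     inv_into (space M) T \<in> measurable M M \<and> distr M M T = M"

definition conservative :: "'a measure \<Rightarrow> ('a \<Rightarrow> 'a) \<Rightarrow> bool" where
  "conservative M T \<longleftrightarrow>
     (\<forall>W\<in>sets M. disjoint_family (\<lambda>k::nat. (T ^^ k) -` W \<inter> space M) \<longrightarrow> emeasure M W = 0)"

definition ergodic :: "'a measure \<Rightarrow> ('a \<Rightarrow> 'a) \<Rightarrow> bool" where
  "ergodic M T \<longleftrightarrow>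
     (\<forall>A\<in>sets M. T -` A \<inter> space M = A \<longrightarrow> emeasure M A = 0 \<or> emeasure M (space M - A) = 0)"

definition int_iterate :: "'a set \<Rightarrow> ('a \<Rightarrow> 'a) \<Rightarrow> int \<Rightarrow> 'a \<Rightarrow> 'a" where
  "int_iterate \<Omega> f k = (if 0 \<le> k then f ^^ nat k else inv_into \<Omega> f ^^ nat (- k))"

definition boundedly_finite :: "'a::metric_space measure \<Rightarrow> bool" where
  "boundedly_finite M \<longleftrightarrow> (\<forall>A\<in>sets M. bounded A \<longrightarrow> emeasure M A < \<infinity>)"

definition finite_pos_sets :: "'a measure \<Rightarrow> 'a set set" where
  "finite_pos_sets M = {A \<in> sets M. 0 < emeasure M A \<and> emeasure M A < \<infinity>}"

text \<open>The complete separable metric space \<open>X\<close> is the whole type.\<close>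

definition infinite_cons_ergodic_system :: "'a::polish_space measure \<Rightarrow> ('a \<Rightarrow> 'a) \<Rightarrow> bool" where
  "infinite_cons_ergodic_system \<mu> T \<longleftrightarrow>
     sets \<mu> = sets borel \<and> boundedly_finite \<mu> \<and> emeasure \<mu> UNIV = \<infinity> \<and>
     invertible_mpt \<mu> T \<and> conservative \<mu> T \<and> ergodic \<mu> T"


section \<open>Point processes\<close>

text \<open>Boundedly finite simple counting measures are identified with their sets of points, that is,
  with the sets having finitely many points in every bounded set.  Such a set is countable.\<close>

definition configurations :: "'a::metric_space set set" where
  "configurations = {\<xi>. \<forall>B\<in>sets borel. bounded B \<longrightarrow> finite (\<xi> \<inter> B)}"

definition num_points :: "'a set \<Rightarrow> 'a set \<Rightarrow> ennreal" where
  "num_points \<xi> A = emeasure (count_space UNIV) (\<xi> \<inter> A)"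

definition configuration_space :: "'a::metric_space set measure" where
  "configuration_space = sigma configurations
     {(\<lambda>\<xi>. num_points \<xi> A) -` B \<inter> configurations | A B.
        A \<in> sets borel \<and> bounded A \<and> B \<in> sets borel}"

definition T_point_process ::
  "'a::polish_space measure \<Rightarrow> ('a \<Rightarrow> 'a) \<Rightarrow> 'w measure \<Rightarrow> ('w \<Rightarrow> 'w) \<Rightarrow> ('w \<Rightarrow> 'a set) \<Rightarrow> bool" where
  "T_point_process \<mu> T M S N \<longleftrightarrow>
     prob_space M \<and> invertible_mpt M S \<and>
     N \<in> measurable M configuration_space \<and>
     (\<forall>A\<in>sets \<mu>. emeasure \<mu> A = 0 \<longrightarrow> (AE \<omega> in M. num_points (N \<omega>) A = 0)) \<and>
     (AE \<omega> in M. \<forall>A\<in>sets \<mu>. num_points (N (S \<omega>)) A = num_points (N \<omega>) (T -` A))"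

definition moments_of_all_orders ::
  "'a measure \<Rightarrow> 'w measure \<Rightarrow> ('w \<Rightarrow> 'a set) \<Rightarrow> bool" where
  "moments_of_all_orders \<mu> M N \<longleftrightarrow>
     (\<forall>n\<ge>1. \<forall>A\<in>finite_pos_sets \<mu>. (\<integral>\<^sup>+\<omega>. num_points (N \<omega>) A ^ n \<partial>M) < \<infinity>)"

definition free_process :: "'w measure \<Rightarrow> ('w \<Rightarrow> 'w) \<Rightarrow> ('w \<Rightarrow> 'a set) \<Rightarrow> bool" where
  "free_process M S N \<longleftrightarrow>
     (AE \<omega> in M. \<forall>k::int. k \<noteq> 0 \<longrightarrow> N \<omega> \<inter> N (int_iterate (space M) S k \<omega>) = {})"

text \<open>The Poisson weights are written out because \<^const>\<open>poisson_pmf\<close> requires a positive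
  rate; here \<open>\<alpha> = 0\<close> is allowed and gives the law concentrated at \<open>0\<close>, as \<open>0 ^ 0 = 1\<close>.\<close>

definition poisson_process ::
  "'a measure \<Rightarrow> real \<Rightarrow> 'w measure \<Rightarrow> ('w \<Rightarrow> 'a set) \<Rightarrow> bool" where
  "poisson_process \<mu> \<alpha> M N \<longleftrightarrow>
     (\<forall>k\<ge>1. \<forall>A :: nat \<Rightarrow> 'a set.
        (\<forall>i\<in>{1..k}. A i \<in> finite_pos_sets \<mu>) \<and> disjoint_family_on A {1..k} \<longrightarrow>
        prob_space.indep_vars M (\<lambda>_. borel) (\<lambda>i \<omega>. num_points (N \<omega>) (A i)) {1..k} \<and>
        (\<forall>i\<in>{1..k}. \<forall>j::nat.
           measure M {\<omega> \<in> space M. num_points (N \<omega>) (A i) = of_nat j} =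
             (\<alpha> * measure \<mu> (A i)) ^ j / fact j * exp (- (\<alpha> * measure \<mu> (A i)))))"


section \<open>Products and the properties (P1) and (P2)\<close>

definition product_map :: "nat \<Rightarrow> ('a \<Rightarrow> 'a) \<Rightarrow> (nat \<Rightarrow> 'a) \<Rightarrow> nat \<Rightarrow> 'a" where
  "product_map n T x = (\<lambda>i\<in>{1..n}. T (x i))"

definition property_P1 :: "'a measure \<Rightarrow> ('a \<Rightarrow> 'a) \<Rightarrow> bool" where
  "property_P1 \<mu> T \<longleftrightarrow> (\<forall>n\<ge>1. ergodic (Pi\<^sub>M {1..n} (\<lambda>_. \<mu>)) (product_map n T))"

text \<open>A subset of \<open>X\<^sup>n\<close> is bounded iff all its coordinate projections are.\<close>

definition boundedly_finite_prod :: "nat \<Rightarrow> (nat \<Rightarrow> 'a::metric_space) measure \<Rightarrow> bool" where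
  "boundedly_finite_prod n \<sigma> \<longleftrightarrow>
     (\<forall>A\<in>sets \<sigma>. (\<forall>i\<in>{1..n}. bounded ((\<lambda>x. x i) ` A)) \<longrightarrow> emeasure \<sigma> A < \<infinity>)"

definition pi_compatible :: "nat set set \<Rightarrow> (nat \<Rightarrow> int) \<Rightarrow> bool" where
  "pi_compatible \<pi> \<kappa> \<longleftrightarrow> (\<forall>P\<in>\<pi>. \<kappa> (Min P) = 0)"

text \<open>\<open>m\<close> is the measure \<open>m\<^sub>\<pi>\<^sup>\<kappa>\<close>, specified by its values on measurable rectangles; these determine
  it, since \<open>X\<^sup>n\<close> is a countable union of rectangles on which they are finite.\<close>

definition is_m_measure ::
  "'a measure \<Rightarrow> ('a \<Rightarrow> 'a) \<Rightarrow> nat \<Rightarrow> nat set set \<Rightarrow> (nat \<Rightarrow> int) \<Rightarrow> (nat \<Rightarrow> 'a) measure \<Rightarrow> bool" where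
  "is_m_measure \<mu> T n \<pi> \<kappa> m \<longleftrightarrow>
     sets m = sets (Pi\<^sub>M {1..n} (\<lambda>_. \<mu>)) \<and>
     (\<forall>A. (\<forall>i\<in>{1..n}. A i \<in> sets \<mu>) \<longrightarrow>
        emeasure m (Pi\<^sub>E {1..n} A) =
          (\<Prod>P\<in>\<pi>. emeasure \<mu> (\<Inter>i\<in>P. int_iterate (space \<mu>) T (\<kappa> i) -` A i)))"

text \<open>An ergodic decomposition \<open>\<sigma> = \<integral> \<rho> d\<Lambda>(\<rho>)\<close>, where \<open>\<Lambda>\<close> is a measure on a space of measures:
  the components are the points of that space.  A decomposition \<open>\<sigma> = \<integral> \<sigma>\<^sub>y d\<nu>(y)\<close> over an arbitrary
  \<open>\<sigma>\<close>-finite parameter space becomes one of this kind by passing to an equivalent finite measure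
  (which rescales the components) and pushing it forward under \<open>y \<mapsto> \<sigma>\<^sub>y\<close>.  \<open>\<Lambda>\<close> is not required to
  be a probability, so that \<open>\<sigma> = 0\<close> has the decomposition \<open>\<Lambda> = 0\<close>, without components.\<close>

definition ergodic_decomposition ::
  "'b measure \<Rightarrow> ('b \<Rightarrow> 'b) \<Rightarrow> 'b measure measure \<Rightarrow> bool" where
  "ergodic_decomposition \<sigma> T \<Lambda> \<longleftrightarrow>
     finite_measure \<Lambda> \<and>
     (\<forall>\<rho>\<in>space \<Lambda>. sets \<rho> = sets \<sigma>) \<and>
     (AE \<rho> in \<Lambda>. distr \<rho> \<rho> T = \<rho> \<and> ergodic \<rho> T) \<and>
     (\<forall>A\<in>sets \<sigma>. (\<lambda>\<rho>. emeasure \<rho> A) \<in> borel_measurable \<Lambda> \<and>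
        emeasure \<sigma> A = (\<integral>\<^sup>+\<rho>. emeasure \<rho> A \<partial>\<Lambda>))"

text \<open>Ergodic decompositions are unique up to null sets and up to scaling of the components, so
  the ergodic components are those of one decomposition, outside a null set.\<close>

definition property_P2 :: "'a::polish_space measure \<Rightarrow> ('a \<Rightarrow> 'a) \<Rightarrow> bool" where
  "property_P2 \<mu> T \<longleftrightarrow>
     (\<forall>n\<ge>1. \<forall>\<sigma> :: (nat \<Rightarrow> 'a) measure.
        sets \<sigma> = sets (Pi\<^sub>M {1..n} (\<lambda>_. \<mu>)) \<and>
        boundedly_finite_prod n \<sigma> \<and>
        distr \<sigma> \<sigma> (product_map n T) = \<sigma> \<and>
        (\<forall>i\<in>{1..n}. absolutely_continuous \<mu> (distr \<sigma> \<mu> (\<lambda>x. x i))) \<longrightarrow>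
        conservative \<sigma> (product_map n T) \<and>
        (\<exists>\<Lambda>. ergodic_decomposition \<sigma> (product_map n T) \<Lambda> \<and>
           (AE \<rho> in \<Lambda>. \<exists>\<pi> \<kappa> m. \<exists>c::real.
              partition_on {1..n} \<pi> \<and> pi_compatible \<pi> \<kappa> \<and> is_m_measure \<mu> T n \<pi> \<kappa> m \<and>
              0 < c \<and> \<rho> = scale_measure (ennreal c) m)))"

end

theory Submission
  imports Defs
begin

text \<open>
  The proof identifies all joint factorial moments of the counts \<open>N(A)\<close> with those of a Poisson
  process.  Let \<open>\<sigma>\<^sub>n(A)\<close> be the expected number of \<open>n\<close>-tuples of pairwise distinct points of \<open>N\<close> that
  lie in \<open>A \<subseteq> X\<^sup>n\<close>, the \<open>n\<close>-th factorial moment measure.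

  The measure \<open>\<sigma>\<^sub>n\<close> is a multiple of \<open>\<mu>\<^sup>n\<close> on rectangles.  Indeed \<open>\<sigma>\<^sub>n\<close> is boundedly finite because \<open>N\<close>
  has moments, it is invariant because \<open>N(S\<omega>) = T(N(\<omega>))\<close> almost surely, and its marginals do not charge
  \<open>\<mu>\<close>-null sets.  So (P2) applies to it: almost every ergodic component is a multiple of some
  \<open>m\<^sub>\<pi>\<^sup>\<kappa>\<close>.  If \<open>\<pi>\<close> has a block with two elements, \<open>m\<^sub>\<pi>\<^sup>\<kappa>\<close> is carried by tuples two of whose
  coordinates are on a common \<open>T\<close>-orbit (\<open>m_measure_concentrated\<close>).  Freeness says that \<open>N\<close> never has two
  distinct points on one orbit, so \<open>\<sigma>\<^sub>n\<close> does not charge such tuples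
  (\<open>factorial_moment_measure_same_orbit\<close>), and neither do its components.  Only multiples of
  \<open>\<mu>\<^sup>n\<close> survive, which gives \<open>\<sigma>\<^sub>n(A\<^sub>1 \<times> \<dots> \<times> A\<^sub>n) = c\<^sub>n \<mu>(A\<^sub>1) \<dots> \<mu>(A\<^sub>n)\<close> (\<open>factorial_moment_rectangle\<close>).

  The constants satisfy \<open>c\<^sub>n = \<alpha>\<^sup>n\<close> with \<open>\<alpha> = c\<^sub>1\<close>.  Only \<open>c\<^sub>1\<close> and \<open>c\<^sub>2\<close> enter the second moments of the counts,
  and \<open>c\<^sub>2\<close> cancels in the mean square of \<open>N(A)/\<mu>(A) - N(B)/\<mu>(B)\<close>, which is at most of
  order \<open>1/\<mu>(A) + 1/\<mu>(B)\<close>.  As \<open>\<mu>\<close> is infinite, one can let the sets grow: the averages \<open>N(B)/\<mu>(B)\<close> converge in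
  mean square.  Replacing \<open>B\<close> by \<open>T\<^sup>-\<^sup>1B\<close> changes them negligibly, so that the limit is \<open>S\<close>-invariant and, by
  ergodicity of \<open>S\<close>, equals its mean \<open>\<alpha>\<close> (\<open>law_of_large_numbers\<close>).  Integrating a factorial moment of \<open>N(Q)\<close>
  against \<open>N(B)/\<mu>(B)\<close> with \<open>B\<close> disjoint from \<open>Q\<close> then gives \<open>c\<^sub>n\<^sub>+\<^sub>1 = \<alpha> c\<^sub>n\<close> (\<open>moment_constant_Suc\<close>).

  Hence for disjoint sets the joint factorial moments are products of powers of the \<open>\<alpha> \<mu>(A\<^sub>i)\<close>.  An
  alternating series expresses the indicator of \<open>{X = j}\<close> through the binomial coefficients of \<open>X\<close>, and it
  converges absolutely in mean at these moments; replacing the falling factorials by indicators one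
  factor at a time (\<open>mixed_moments\<close>) yields the joint law of the counts.
\<close>

section \<open>Counting injective tuples\<close>

lemma falling_factorial_Suc:
  "fact (Suc m) * (x choose Suc m) = (x - m) * (fact m * (x choose m) :: nat)"
proof -
  have "Suc m * (x choose Suc m) = (x - m) * (x choose m)"
    by (metis binomial_absorb_comp binomial_absorption mult.commute)
  then show ?thesis
    by (metis (no_types, opaque_lifting) fact_Suc mult.assoc mult.commute of_nat_id)
qed

text \<open>The coordinates with label \<open>i\<close> form an injective choice in \<open>F i\<close>, independently of the other labels since
the \<open>F i\<close> are disjoint; each label therefore contributes the falling factorial of \<open>card (F i)\<close>.  The
induction appends one coordinate, which has to avoid just the earlier coordinates with the same label.\<close>

lemma card_injective_tuples:
  fixes F :: "'b \<Rightarrow> 'a set" and g :: "'c \<Rightarrow> 'b"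
  assumes "finite L" "finite I" "g ` L \<subseteq> I"
    and fin: "\<And>i. i \<in> I \<Longrightarrow> finite (F i)" and disj: "disjoint_family_on F I"
  shows "card {x \<in> Pi\<^sub>E L (\<lambda>l. F (g l)). inj_on x L} =
    (\<Prod>i\<in>I. fact (card {l\<in>L. g l = i}) * (card (F i) choose card {l\<in>L. g l = i}))"
  using assms(1,3)
proof (induction L)
  case empty
  have "{x \<in> Pi\<^sub>E {} (\<lambda>l. F (g l)). inj_on x {}} = {\<lambda>_. undefined}" by auto
  then show ?case by simp
next
  case (insert a L)
  let ?S = "\<lambda>L. {x \<in> Pi\<^sub>E L (\<lambda>l. F (g l)). inj_on x L}"
  define m where "m = card {l\<in>L. g l = g a}"
  have gaI: "g a \<in> I" and gL: "g ` L \<subseteq> I" using insert.prems by auto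
  have finS: "finite (?S L)"
    by (rule finite_subset[of _ "Pi\<^sub>E L (\<lambda>l. F (g l))"]) (use insert.hyps gL fin in \<open>auto intro!: finite_PiE\<close>)
  have bij: "bij_betw (\<lambda>(x, y). x(a := y)) (Sigma (?S L) (\<lambda>x. F (g a) - x ` L)) (?S (insert a L))"
  proof (rule bij_betwI[where g = "\<lambda>z. (z(a := undefined), z a)"])
    show "(\<lambda>(x, y). x(a := y)) \<in> Sigma (?S L) (\<lambda>x. F (g a) - x ` L) \<rightarrow> ?S (insert a L)"
    proof
      fix p assume "p \<in> Sigma (?S L) (\<lambda>x. F (g a) - x ` L)"
      then obtain x y where p: "p = (x, y)"
        and h: "x \<in> Pi\<^sub>E L (\<lambda>l. F (g l))" "inj_on x L" "y \<in> F (g a)" "y \<notin> x ` L" by blast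
      have "x(a := y) \<in> Pi\<^sub>E (insert a L) (\<lambda>l. F (g l))"
        using h insert.hyps by (auto simp: PiE_iff extensional_def)
      moreover have "inj_on (x(a := y)) (insert a L)"
        using h insert.hyps by (auto simp: inj_on_def image_iff)
      ultimately show "(case p of (x, y) \<Rightarrow> x(a := y)) \<in> ?S (insert a L)" by (simp add: p)
    qed
    show "(\<lambda>z. (z(a := undefined), z a)) \<in> ?S (insert a L) \<rightarrow> Sigma (?S L) (\<lambda>x. F (g a) - x ` L)"
    proof
      fix z assume z: "z \<in> ?S (insert a L)"
      have "z(a := undefined) \<in> Pi\<^sub>E L (\<lambda>l. F (g l))"
        using z insert.hyps by (auto simp: PiE_iff extensional_def)
      moreover have "inj_on (z(a := undefined)) L" "z a \<notin> (z(a := undefined)) ` L" "z a \<in> F (g a)"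
        using z insert.hyps by (auto simp: inj_on_def PiE_iff)
      ultimately show "(z(a := undefined), z a) \<in> Sigma (?S L) (\<lambda>x. F (g a) - x ` L)" by auto
    qed
    show "\<And>z. z \<in> Sigma (?S L) (\<lambda>x. F (g a) - x ` L) \<Longrightarrow>
       (((case z of (x, y) \<Rightarrow> x(a := y))(a := undefined)), (case z of (x, y) \<Rightarrow> x(a := y)) a) = z"
      using insert.hyps by (auto simp: PiE_iff extensional_def fun_eq_iff)
  qed auto
  have fiber: "card (F (g a) - x ` L) = card (F (g a)) - m" if x: "x \<in> ?S L" for x
  proof -
    have mem: "x l \<in> F (g a) \<longleftrightarrow> g l = g a" if "l \<in> L" for l
    proof -
      have "x l \<in> F (g l)" "g l \<in> I" using x that gL by auto
      then show ?thesis using disj gaI unfolding disjoint_family_on_def by fastforce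
    qed
    have "x ` L \<inter> F (g a) = x ` {l\<in>L. g l = g a}" using mem by auto
    moreover have "card (x ` {l\<in>L. g l = g a}) = m"
      unfolding m_def using x by (auto intro!: card_image inj_on_subset[of x L])
    moreover have "card (F (g a) - x ` L) = card (F (g a)) - card (F (g a) \<inter> x ` L)"
      by (rule card_Diff_subset_Int) (use insert.hyps in auto)
    ultimately show ?thesis by (simp add: Int_commute)
  qed
  have same: "{l \<in> insert a L. g l = i} = {l\<in>L. g l = i}" if "i \<noteq> g a" for i
    using that by auto
  have cm: "card {l \<in> insert a L. g l = g a} = Suc m"
  proof -
    have "{l \<in> insert a L. g l = g a} = insert a {l\<in>L. g l = g a}" by auto
    then show ?thesis unfolding m_def using insert.hyps by simp
  qed
  have "card (?S (insert a L)) = card (Sigma (?S L) (\<lambda>x. F (g a) - x ` L))"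
    using bij_betw_same_card[OF bij] by simp
  also have "\<dots> = (\<Sum>x\<in>?S L. card (F (g a) - x ` L))"
    using finS fin gaI by (intro card_SigmaI) auto
  also have "\<dots> = (card (F (g a)) - m) * card (?S L)"
    using fiber by simp
  also have "\<dots> = (card (F (g a)) - m) *
      (\<Prod>i\<in>I. fact (card {l\<in>L. g l = i}) * (card (F i) choose card {l\<in>L. g l = i}))"
    using insert.IH gL by simp
  also have "\<dots> = (card (F (g a)) - m) * (fact m * (card (F (g a)) choose m)) *
      (\<Prod>i\<in>I - {g a}. fact (card {l\<in>L. g l = i}) * (card (F i) choose card {l\<in>L. g l = i}))"
    using assms(2) gaI by (simp add: prod.remove[of I "g a"] m_def mult_ac)
  also have "\<dots> = (\<Prod>i\<in>I. fact (card {l\<in>insert a L. g l = i}) *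
      (card (F i) choose card {l\<in>insert a L. g l = i}))"
    unfolding prod.remove[OF assms(2) gaI] cm falling_factorial_Suc
    by (intro arg_cong2[of _ _ _ _ "(*)"] prod.cong) (simp_all only: same Diff_iff singleton_iff not_False_eq_True)
  finally show ?case .
qed

text \<open>Turns a family of exponents \<open>e i\<close> into a labelling of the coordinates \<open>1, \<dots>, n\<close>, so that a product of falling
factorials of counts can be read as a count of injective \<open>n\<close>-tuples.\<close>

lemma exists_map_with_fibers:
  assumes "finite I"
  shows "\<exists>g::nat \<Rightarrow> 'i. g ` {1..sum e I} \<subseteq> I \<and> (\<forall>i\<in>I. card {l\<in>{1..sum e I}. g l = i} = e i)"
proof -
  let ?n = "sum e I" and ?S = "Sigma I (\<lambda>i. {..<e i})"
  have "card ?S = ?n" using assms by simp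
  then have "\<exists>h. bij_betw h {1..?n} ?S"
    using assms by (intro finite_same_card_bij) simp_all
  then obtain h where h: "bij_betw h {1..?n} ?S" by blast
  have "card {l\<in>{1..?n}. fst (h l) = i} = e i" if "i \<in> I" for i
  proof -
    have "h ` {l\<in>{1..?n}. fst (h l) = i} = {p \<in> h ` {1..?n}. fst p = i}" by blast
    also have "\<dots> = {p \<in> ?S. fst p = i}" by (simp only: bij_betw_imp_surj_on[OF h])
    also have "\<dots> = {i} \<times> {..<e i}" using that by auto
    finally have "card (h ` {l\<in>{1..?n}. fst (h l) = i}) = e i" by simp
    moreover have "card (h ` {l\<in>{1..?n}. fst (h l) = i}) = card {l\<in>{1..?n}. fst (h l) = i}"
      by (rule card_image) (use h in \<open>auto simp: bij_betw_def intro: inj_on_subset\<close>)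
    ultimately show ?thesis by simp
  qed
  moreover have "(fst \<circ> h) ` {1..?n} \<subseteq> I" using bij_betwE[OF h] by fastforce
  ultimately show ?thesis by (intro exI[of _ "fst \<circ> h"]) auto
qed

lemma emeasure_count_space_bij:
  "bij_betw f A B \<Longrightarrow> emeasure (count_space UNIV) A = emeasure (count_space UNIV) B"
  by (simp add: emeasure_count_space bij_betw_finite bij_betw_same_card)

lemma partition_all_singletons:
  assumes "partition_on A \<pi>" "\<And>P i j. P \<in> \<pi> \<Longrightarrow> i \<in> P \<Longrightarrow> j \<in> P \<Longrightarrow> i = j"
  shows "\<pi> = (\<lambda>i. {i}) ` A"
proof -
  have "P = {i}" if "P \<in> \<pi>" "i \<in> P" for P i using assms(2)[OF that(1)] that by blast
  moreover have "P \<noteq> {}" if "P \<in> \<pi>" for P using assms(1) that by (auto simp: partition_on_def)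
  moreover have "\<Union>\<pi> = A" using assms(1) by (simp add: partition_on_def)
  ultimately show ?thesis by (auto simp: image_iff) (metis UnionI ex_in_conv)+
qed

section \<open>Poisson laws from factorial moments\<close>

text \<open>Inclusion and exclusion: \<open>(x choose (j + r)) * ((j + r) choose j) = (x choose j) * ((x - j) choose r)\<close>, and
the alternating sum of the binomial coefficients of \<open>x - j\<close> vanishes unless \<open>x = j\<close>.\<close>

lemma indicator_singleton_factorial_series:
  fixes x j :: nat
  shows "(\<lambda>r. (-1) ^ r * real ((j + r) choose j) * real (x choose (j + r))) sums (indicator {j} x :: real)"
proof -
  let ?t = "\<lambda>r. (-1) ^ r * real ((j + r) choose j) * real (x choose (j + r)) :: real"
  have z: "?t r = 0" if "r \<notin> {..x}" for r using that by (simp add: binomial_eq_0)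
  have s: "?t sums (\<Sum>r\<le>x. ?t r)" by (rule sums_finite) (use z in auto)
  have eq: "(\<Sum>r\<le>x. ?t r) = indicator {j} x"
  proof (cases "j \<le> x")
    case True
    have t: "?t r = real (x choose j) * ((-1) ^ r * real ((x - j) choose r))" for r
    proof (cases "j + r \<le> x")
      case True
      then have "(x choose (j + r)) * ((j + r) choose j) = (x choose j) * ((x - j) choose r)"
        using choose_mult[of j "j + r" x] by simp
      then show ?thesis by (metis (no_types, lifting) mult.assoc mult.commute of_nat_mult)
    next
      case False
      then show ?thesis using \<open>j \<le> x\<close> by (simp add: binomial_eq_0)
    qed
    have "(\<Sum>r\<le>x. ?t r) = real (x choose j) * (\<Sum>r\<le>x. (-1) ^ r * real ((x - j) choose r))"
      by (simp only: t sum_distrib_left)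
    also have "(\<Sum>r\<le>x. (-1) ^ r * real ((x - j) choose r)) = (\<Sum>r\<le>x-j. (-1) ^ r * real ((x - j) choose r))"
      by (rule sum.mono_neutral_right) (auto simp: binomial_eq_0)
    also have "real (x choose j) * \<dots> = indicator {j} x"
    proof (cases "x = j")
      case False
      then show ?thesis using True choose_alternating_sum[of "x - j", where ?'a = real] by simp
    qed simp
    finally show ?thesis .
  next
    case False
    then show ?thesis by (auto simp: binomial_eq_0 indicator_def)
  qed
  show ?thesis using s unfolding eq .
qed

definition poisson_mass :: "real \<Rightarrow> nat set \<Rightarrow> real" where
  "poisson_mass l B = (\<Sum>j. indicator B j * (l ^ j / fact j * exp (- l)))"

lemma poisson_mass_singleton: "poisson_mass l {j} = l ^ j / fact j * exp (- l)"
proof -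
  have "(\<lambda>i. indicator {j} i * (l ^ i / fact i * exp (- l))) = (\<lambda>i. if i = j then l ^ i / fact i * exp (- l) else 0)"
    by (auto simp: fun_eq_iff indicator_def)
  then show ?thesis
    unfolding poisson_mass_def using sums_single[of j "\<lambda>i. l ^ i / fact i * exp (- l)"] by (simp add: sums_iff)
qed

text \<open>The factorial moments \<open>l ^ m\<close> grow slowly enough for the series of the preceding lemma to be integrated term by
term.  The weight \<open>Y\<close> carries the factors that belong to other variables: the conclusion says that under the
measure with density \<open>Y\<close>, of total mass \<open>e\<close>, the variable \<open>X\<close> is Poisson with parameter \<open>l\<close>.\<close>

lemma poisson_law_from_factorial_moments:
  fixes Y :: "'w \<Rightarrow> real" and X :: "'w \<Rightarrow> nat" and B :: "nat set"
  assumes [measurable]: "X \<in> measurable M (count_space UNIV)"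
    and nonneg: "\<And>\<omega>. 0 \<le> Y \<omega>" "0 \<le> l"
    and int: "\<And>m. integrable M (\<lambda>\<omega>. Y \<omega> * real (fact m * (X \<omega> choose m)))"
    and eq: "\<And>m. (\<integral>\<omega>. Y \<omega> * real (fact m * (X \<omega> choose m)) \<partial>M) = e * l ^ m"
  shows "(\<integral>\<omega>. Y \<omega> * indicator B (X \<omega>) \<partial>M) = e * poisson_mass l B"
proof -
  have [measurable]: "Y \<in> borel_measurable M" and intY: "integrable M Y"
    using int[of 0] by auto
  have chooseint: "integrable M (\<lambda>\<omega>. Y \<omega> * real (X \<omega> choose m))"
    and choose: "(\<integral>\<omega>. Y \<omega> * real (X \<omega> choose m) \<partial>M) = e * l ^ m / fact m" for m
  proof -
    have r: "Y \<omega> * real (X \<omega> choose m) = Y \<omega> * real (fact m * (X \<omega> choose m)) / fact m" for \<omega>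
      by simp
    show "integrable M (\<lambda>\<omega>. Y \<omega> * real (X \<omega> choose m))"
      unfolding r by (intro integrable_divide int)
    show "(\<integral>\<omega>. Y \<omega> * real (X \<omega> choose m) \<partial>M) = e * l ^ m / fact m"
      unfolding r using eq[of m] by (simp add: field_simps)
  qed
  have atom: "(\<integral>\<omega>. Y \<omega> * indicator {j} (X \<omega>) \<partial>M) = e * (l ^ j / fact j * exp (- l))" for j
  proof -
    let ?f = "\<lambda>r \<omega>. ((-1) ^ r * real ((j + r) choose j)) * (Y \<omega> * real (X \<omega> choose (j + r)))"
    have coeff: "real ((j + r) choose j) * (e * l ^ (j + r) / fact (j + r)) = e * l ^ j / fact j * (l ^ r / fact r)" for r
    proof -
      have "real ((j + r) choose j) = fact (j + r) / (fact j * fact r)"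
        using binomial_fact[of j "j + r", where ?'a = real] by simp
      then show ?thesis by (simp add: power_add field_simps)
    qed
    have fsum: "(\<lambda>r. ?f r \<omega>) sums (Y \<omega> * indicator {j} (X \<omega>))" for \<omega>
      using sums_mult[OF indicator_singleton_factorial_series[of j "X \<omega>"], of "Y \<omega>"]
      by (simp add: mult_ac)
    have fint: "integrable M (?f r)" for r by (intro integrable_mult_right chooseint)
    have nf: "norm (?f r \<omega>) = real ((j + r) choose j) * (Y \<omega> * real (X \<omega> choose (j + r)))" for r \<omega>
      using nonneg by (simp add: abs_mult)
    have "summable (\<lambda>r. norm (?f r \<omega>))" for \<omega>
      by (rule summable_finite[of "{..X \<omega>}"]) (auto simp: binomial_eq_0)
    moreover have "summable (\<lambda>r. \<integral>\<omega>. norm (?f r \<omega>) \<partial>M)"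
    proof -
      have "(\<integral>\<omega>. norm (?f r \<omega>) \<partial>M) = e * l ^ j / fact j * (l ^ r / fact r)" for r
        unfolding nf using choose[of "j + r"] coeff[of r] by simp
      moreover have "summable (\<lambda>r. l ^ r / fact r)"
        using summable_exp[of l] by (simp add: divide_inverse mult.commute)
      ultimately show ?thesis by (simp only: summable_mult)
    qed
    ultimately have "(\<lambda>r. \<integral>\<omega>. ?f r \<omega> \<partial>M) sums (\<integral>\<omega>. (\<Sum>r. ?f r \<omega>) \<partial>M)"
      by (intro sums_integral fint) auto
    moreover have "(\<Sum>r. ?f r \<omega>) = Y \<omega> * indicator {j} (X \<omega>)" for \<omega>
      using fsum by (rule sums_unique[symmetric])
    moreover have "(\<integral>\<omega>. ?f r \<omega> \<partial>M) = e * l ^ j / fact j * ((- l) ^ r / fact r)" for r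
    proof -
      have "(\<integral>\<omega>. ?f r \<omega> \<partial>M) = (-1) ^ r * (real ((j + r) choose j) * (e * l ^ (j + r) / fact (j + r)))"
        using choose[of "j + r"] by (simp only: integral_mult_right_zero mult.assoc)
      also have "\<dots> = (-1) ^ r * (e * l ^ j / fact j * (l ^ r / fact r))" by (simp only: coeff)
      also have "\<dots> = e * l ^ j / fact j * ((- l) ^ r / fact r)"
        by (simp add: power_minus[of l r])
      finally show ?thesis .
    qed
    ultimately have "(\<lambda>r. e * l ^ j / fact j * ((- l) ^ r / fact r)) sums (\<integral>\<omega>. Y \<omega> * indicator {j} (X \<omega>) \<partial>M)"
      by simp
    moreover have "(\<lambda>r. e * l ^ j / fact j * ((- l) ^ r / fact r)) sums (e * l ^ j / fact j * exp (- l))"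
      using exp_converges[of "- l"] by (intro sums_mult) (simp add: divide_inverse mult.commute)
    ultimately have "(\<integral>\<omega>. Y \<omega> * indicator {j} (X \<omega>) \<partial>M) = e * l ^ j / fact j * exp (- l)"
      by (rule sums_unique2)
    then show ?thesis by simp
  qed
  let ?g = "\<lambda>j \<omega>. indicator B j * (Y \<omega> * indicator {j} (X \<omega>)) :: real"
  have gs: "(\<lambda>j. ?g j \<omega>) sums (Y \<omega> * indicator B (X \<omega>))" for \<omega>
  proof -
    have "?g j \<omega> = (if j = X \<omega> then indicator B j * Y \<omega> else 0)" for j
      by (simp add: indicator_def)
    then show ?thesis
      using sums_single[of "X \<omega>" "\<lambda>j. indicator B j * Y \<omega> :: real"] by (simp add: mult.commute)
  qed
  have i1: "integrable M (\<lambda>\<omega>. Y \<omega> * indicator {j} (X \<omega>))" for j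
    by (rule Bochner_Integration.integrable_bound[OF intY]) (auto simp: indicator_def)
  have "summable (\<lambda>j. norm (?g j \<omega>))" for \<omega>
    by (rule summable_finite[of "{X \<omega>}"]) (auto simp: indicator_def)
  moreover have "summable (\<lambda>j. \<integral>\<omega>. norm (?g j \<omega>) \<partial>M)"
  proof (rule summable_comparison_test)
    have n: "norm (?g j \<omega>) = indicator B j * (Y \<omega> * indicator {j} (X \<omega>))" for j \<omega>
      using nonneg by (simp add: abs_mult indicator_def)
    show "\<exists>N. \<forall>j\<ge>N. norm (\<integral>\<omega>. norm (?g j \<omega>) \<partial>M) \<le> \<bar>e\<bar> * exp (- l) * (l ^ j / fact j)"
    proof (intro exI allI impI)
      fix j
      have "(\<integral>\<omega>. norm (?g j \<omega>) \<partial>M) = indicator B j * (e * (l ^ j / fact j * exp (- l)))"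
        unfolding n using atom[of j] by simp
      then show "norm (\<integral>\<omega>. norm (?g j \<omega>) \<partial>M) \<le> \<bar>e\<bar> * exp (- l) * (l ^ j / fact j)"
        using nonneg by (simp add: abs_mult indicator_def mult_ac)
    qed
    show "summable (\<lambda>j. \<bar>e\<bar> * exp (- l) * (l ^ j / fact j))"
      using summable_exp[of l] by (simp add: summable_mult divide_inverse mult.commute)
  qed
  ultimately have "(\<integral>\<omega>. (\<Sum>j. ?g j \<omega>) \<partial>M) = (\<Sum>j. \<integral>\<omega>. ?g j \<omega> \<partial>M)"
    by (intro integral_suminf) (auto intro!: i1)
  moreover have "(\<integral>\<omega>. ?g j \<omega> \<partial>M) = e * (indicator B j * (l ^ j / fact j * exp (- l)))" for j
    using atom[of j] by simp
  moreover have "(\<Sum>j. ?g j \<omega>) = Y \<omega> * indicator B (X \<omega>)" for \<omega>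
    using gs by (rule sums_unique[symmetric])
  moreover have "summable (\<lambda>j. indicator B j * (l ^ j / fact j * exp (- l)))"
  proof (rule summable_comparison_test)
    show "\<exists>N. \<forall>j\<ge>N. norm (indicator B j * (l ^ j / fact j * exp (- l))) \<le> exp (- l) * (l ^ j / fact j)"
      using nonneg by (auto simp: abs_mult indicator_def mult_ac)
    show "summable (\<lambda>j. exp (- l) * (l ^ j / fact j))"
      using summable_exp[of l] by (simp add: summable_mult divide_inverse mult.commute)
  qed
  ultimately show ?thesis by (simp only: suminf_mult poisson_mass_def)
qed

section \<open>Almost sure convergence and almost invariant sets\<close>

text \<open>A form of the Cauchy-Schwarz inequality that can be integrated directly; the weight \<open>4 ^ j\<close> suits second
factors whose mean square is of order \<open>16\<^sup>-\<^sup>j\<close>.\<close>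

lemma abs_mult_le_weighted_squares:
  fixes a b :: real
  shows "\<bar>a * b\<bar> \<le> a\<^sup>2 / 4 ^ j + 4 ^ j * b\<^sup>2"
proof -
  have "0 \<le> (\<bar>a\<bar> / 2 ^ j - 2 ^ j * \<bar>b\<bar>)\<^sup>2" by simp
  also have "\<dots> = a\<^sup>2 / 4 ^ j + 4 ^ j * b\<^sup>2 - 2 * \<bar>a * b\<bar>"
    by (simp add: power2_diff power_mult_distrib power_divide abs_mult flip: power_mult)
       (simp add: power_mult mult.commute[of j])
  finally show ?thesis by simp
qed

lemma eq_zero_of_geometric_bound:
  fixes x :: real
  assumes "\<And>j::nat. \<bar>x\<bar> \<le> K / 4 ^ j"
  shows "x = 0"
proof -
  have "(\<lambda>j. K * (1/4) ^ j) \<longlonglongrightarrow> K * 0" by (intro tendsto_mult tendsto_const LIMSEQ_power_zero) auto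
  then have "\<bar>x\<bar> \<le> K * 0"
    by (rule LIMSEQ_le_const) (use assms in \<open>auto simp: power_divide\<close>)
  then show ?thesis by simp
qed

lemma convergent_of_summable_increments:
  fixes f :: "nat \<Rightarrow> real"
  assumes "summable (\<lambda>j. 4 ^ j * (f j - f (Suc j))\<^sup>2)"
  shows "convergent f"
proof -
  have "summable (\<lambda>j. f (Suc j) - f j)"
  proof (rule summable_comparison_test)
    show "summable (\<lambda>j. 4 ^ j * (f j - f (Suc j))\<^sup>2 + (1/4) ^ j)"
      using assms by (intro summable_add summable_geometric) auto
    show "\<exists>N. \<forall>j\<ge>N. norm (f (Suc j) - f j) \<le> 4 ^ j * (f j - f (Suc j))\<^sup>2 + (1/4) ^ j"
      using abs_mult_le_weighted_squares[of 1 "f j - f (Suc j)" for j]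
      by (simp add: power_divide abs_minus_commute add.commute)
  qed
  then have "convergent (\<lambda>m. f m - f 0)"
    by (simp add: summable_iff_convergent sum_lessThan_telescope)
  then have "convergent (\<lambda>m. (f m - f 0) + f 0)" by (intro convergent_add convergent_const)
  then show ?thesis by simp
qed

lemma AE_summable_of_summable_integrals:
  fixes u :: "nat \<Rightarrow> 'w \<Rightarrow> real"
  assumes int: "\<And>j. integrable M (u j)" and nonneg: "\<And>j \<omega>. 0 \<le> u j \<omega>"
    and le: "\<And>j. (\<integral>\<omega>. u j \<omega> \<partial>M) \<le> b j" and b: "summable b"
  shows "AE \<omega> in M. summable (\<lambda>j. u j \<omega>)"
proof -
  have [measurable]: "u j \<in> borel_measurable M" for j
    by (rule borel_measurable_integrable[OF int])
  have b0: "0 \<le> b j" for j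
    by (rule order_trans[OF Bochner_Integration.integral_nonneg le]) (rule nonneg)
  have "(\<integral>\<^sup>+\<omega>. (\<Sum>j. ennreal (u j \<omega>)) \<partial>M) = (\<Sum>j. \<integral>\<^sup>+\<omega>. ennreal (u j \<omega>) \<partial>M)"
    by (intro nn_integral_suminf) auto
  also have "\<dots> = (\<Sum>j. ennreal (\<integral>\<omega>. u j \<omega> \<partial>M))"
    using int nonneg by (simp add: nn_integral_eq_integral)
  also have "\<dots> \<le> (\<Sum>j. ennreal (b j))" by (intro suminf_le ennreal_leI le) auto
  also have "\<dots> = ennreal (\<Sum>j. b j)" using b b0 by (intro suminf_ennreal2)
  finally have "(\<integral>\<^sup>+\<omega>. (\<Sum>j. ennreal (u j \<omega>)) \<partial>M) \<noteq> \<infinity>" by (auto simp: top_unique)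
  then have "AE \<omega> in M. (\<Sum>j. ennreal (u j \<omega>)) \<noteq> \<infinity>" by (intro nn_integral_PInf_AE) auto
  then show ?thesis
    by eventually_elim (rule summable_suminf_not_top, use nonneg in auto)
qed

text \<open>The set of points whose orbit is eventually in \<open>C\<close> is strictly invariant, and it differs from \<open>C\<close> by a null set.\<close>

lemma almost_invariant_set_trivial:
  assumes "prob_space M" "S \<in> measurable M M" "distr M M S = M" "ergodic M S"
    and [measurable]: "C \<in> sets M" and inv: "AE \<omega> in M. S \<omega> \<in> C \<longleftrightarrow> \<omega> \<in> C"
  shows "(AE \<omega> in M. \<omega> \<in> C) \<or> (AE \<omega> in M. \<omega> \<notin> C)"
proof -
  interpret prob_space M by fact
  note [measurable] = assms(2)
  have [measurable]: "(S ^^ n) \<in> measurable M M" for n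
    by (induction n) auto
  have AES: "AE \<omega> in M. P (S \<omega>)" if "AE \<omega> in M. P \<omega>" for P
  proof -
    have "AE \<omega> in distr M M S. P \<omega>" using that by (simp only: assms(3))
    then show ?thesis by (rule AE_distrD[OF assms(2)])
  qed
  have step: "AE \<omega> in M. (S ^^ n) \<omega> \<in> C \<longleftrightarrow> \<omega> \<in> C" for n
  proof (induction n)
    case (Suc n)
    from AES[OF Suc] inv show ?case by eventually_elim (simp add: funpow_swap1)
  qed simp
  define C' where "C' = {\<omega> \<in> space M. \<exists>n0. \<forall>n\<ge>n0. (S ^^ n) \<omega> \<in> C}"
  have [measurable]: "C' \<in> sets M" unfolding C'_def by measurable
  have "S -` C' \<inter> space M = C'"
  proof (intro set_eqI iffI)
    fix \<omega> assume "\<omega> \<in> S -` C' \<inter> space M"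
    then obtain n0 where w: "\<omega> \<in> space M" "\<forall>n\<ge>n0. (S ^^ n) (S \<omega>) \<in> C" by (auto simp: C'_def)
    have "(S ^^ n) \<omega> \<in> C" if "n \<ge> Suc n0" for n
      using w(2)[rule_format, of "n - 1"] that by (cases n) (auto simp: funpow_swap1)
    then show "\<omega> \<in> C'" using w by (auto simp: C'_def)
  next
    fix \<omega> assume "\<omega> \<in> C'"
    then obtain n0 where w: "\<omega> \<in> space M" "\<forall>n\<ge>n0. (S ^^ n) \<omega> \<in> C" by (auto simp: C'_def)
    have "\<forall>n\<ge>n0. (S ^^ n) (S \<omega>) \<in> C" using w(2) by (metis funpow_Suc_right comp_apply le_Suc_eq)
    then show "\<omega> \<in> S -` C' \<inter> space M"
      using w(1) measurable_space[OF assms(2)] by (auto simp: C'_def)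
  qed
  then have "emeasure M C' = 0 \<or> emeasure M (space M - C') = 0"
    using assms(4) unfolding ergodic_def by auto
  moreover have "AE \<omega> in M. \<omega> \<in> C' \<longleftrightarrow> \<omega> \<in> C"
  proof -
    have "AE \<omega> in M. \<forall>n. (S ^^ n) \<omega> \<in> C \<longleftrightarrow> \<omega> \<in> C" using step by (simp add: AE_all_countable)
    with AE_space show ?thesis by eventually_elim (auto simp: C'_def)
  qed
  ultimately show ?thesis
  proof (elim disjE)
    assume "emeasure M C' = 0"
    then have "AE \<omega> in M. \<omega> \<notin> C'" by (intro AE_not_in) (auto simp: null_sets_def)
    with \<open>AE \<omega> in M. \<omega> \<in> C' \<longleftrightarrow> \<omega> \<in> C\<close> have "AE \<omega> in M. \<omega> \<notin> C" by eventually_elim auto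
    then show ?thesis ..
  next
    assume "emeasure M (space M - C') = 0"
    then have "AE \<omega> in M. \<omega> \<notin> space M - C'" by (intro AE_not_in) (auto simp: null_sets_def)
    with AE_space \<open>AE \<omega> in M. \<omega> \<in> C' \<longleftrightarrow> \<omega> \<in> C\<close> have "AE \<omega> in M. \<omega> \<in> C"
      by eventually_elim auto
    then show ?thesis ..
  qed
qed

section \<open>Factorial moment measures of an invariant point process\<close>

text \<open>What follows from equivariance and moments alone: the factorial moment measures satisfy the hypotheses of (P2),
and there are sets of large measure to average over.\<close>

locale invariant_point_process =
  fixes \<mu> :: "'a::polish_space measure" and T :: "'a \<Rightarrow> 'a"
    and M :: "'w measure" and S :: "'w \<Rightarrow> 'w" and N :: "'w \<Rightarrow> 'a set"
  assumes system: "infinite_cons_ergodic_system \<mu> T"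
    and process: "T_point_process \<mu> T M S N"
    and moments: "moments_of_all_orders \<mu> M N"
begin

sublocale prob_space M
  using process unfolding T_point_process_def by simp

lemma sets_\<mu> [measurable_cong, simp]: "sets \<mu> = sets borel"
  using system by (simp add: infinite_cons_ergodic_system_def)

lemma space_\<mu> [simp]: "space \<mu> = UNIV"
  using sets_eq_imp_space_eq[OF sets_\<mu>] by simp

lemma bij_T: "bij T" and measurable_T [measurable]: "T \<in> borel_measurable borel"
  and measurable_inv_T [measurable]: "inv T \<in> borel_measurable borel"
  and distr_T: "distr \<mu> \<mu> T = \<mu>"
proof -
  have i: "invertible_mpt \<mu> T" using system by (simp add: infinite_cons_ergodic_system_def)
  have e: "measurable \<mu> \<mu> = borel_measurable borel" by (rule measurable_cong_sets) simp_all
  show "bij T" "T \<in> borel_measurable borel" "inv T \<in> borel_measurable borel" "distr \<mu> \<mu> T = \<mu>"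
    using i unfolding invertible_mpt_def e by simp_all
qed

lemma measurable_S [measurable]: "S \<in> measurable M M" and distr_S: "distr M M S = M"
  using process by (auto simp: T_point_process_def invertible_mpt_def)

lemma AE_S: "AE \<omega> in M. P \<omega> \<Longrightarrow> AE \<omega> in M. P (S \<omega>)"
proof -
  assume "AE \<omega> in M. P \<omega>"
  then have "AE \<omega> in distr M M S. P \<omega>" by (simp only: distr_S)
  then show ?thesis by (rule AE_distrD[OF measurable_S])
qed

text \<open>An exhaustion by bounded sets; the centre of the balls is arbitrary.\<close>

definition window :: "nat \<Rightarrow> 'a set" where
  "window m = ball undefined (real m)"

lemma window [measurable]: "window m \<in> sets borel"
  and bounded_window: "bounded (window m)"
  and window_mono: "m \<le> m' \<Longrightarrow> window m \<subseteq> window m'"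
  and Union_window: "(\<Union>m. window m) = UNIV"
  and bounded_subset_window: "bounded B \<Longrightarrow> \<exists>m. B \<subseteq> window m"
proof -
  show "\<exists>m. B \<subseteq> window m" if B: "bounded B"
  proof -
    obtain e where e: "\<And>y. y \<in> B \<Longrightarrow> dist undefined y \<le> e"
      using bounded_any_center[THEN iffD1, OF B, of undefined] by blast
    obtain m :: nat where "e < real m" using reals_Archimedean2 by blast
    then have "B \<subseteq> window m" unfolding window_def using e by force
    then show ?thesis ..
  qed
  have "x \<in> (\<Union>m. window m)" for x
    unfolding window_def using reals_Archimedean2[of "dist undefined x"] by auto
  then show "(\<Union>m. window m) = UNIV" by auto
qed (auto simp: window_def)

lemma window_finite: "emeasure \<mu> (window m) < \<infinity>"
  using system bounded_window by (simp add: infinite_cons_ergodic_system_def boundedly_finite_def)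

lemma N_configuration: "\<omega> \<in> space M \<Longrightarrow> N \<omega> \<in> configurations"
proof -
  assume w: "\<omega> \<in> space M"
  have "N \<in> measurable M configuration_space" using process by (simp add: T_point_process_def)
  then have "N \<omega> \<in> space configuration_space" using w by (rule measurable_space)
  then show ?thesis by (simp add: configuration_space_def space_measure_of_conv)
qed

lemma finite_points_window: "\<omega> \<in> space M \<Longrightarrow> finite (N \<omega> \<inter> window m)"
  using N_configuration bounded_window unfolding configurations_def by simp

lemma measurable_num_points [measurable]:
  assumes [measurable]: "A \<in> sets borel"
  shows "(\<lambda>\<omega>. num_points (N \<omega>) A) \<in> borel_measurable M"
proof -
  have [measurable]: "N \<in> measurable M configuration_space" using process by (simp add: T_point_process_def)
  have bdd: "(\<lambda>\<omega>. num_points (N \<omega>) B) \<in> borel_measurable M" if B: "B \<in> sets borel" "bounded B" for B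
  proof -
    let ?G = "{(\<lambda>\<xi>. num_points \<xi> A) -` B \<inter> configurations | A B. (A::'a set) \<in> sets borel \<and> bounded A \<and> B \<in> sets borel}"
    have "(\<lambda>\<xi>. num_points \<xi> B) \<in> borel_measurable configuration_space"
    proof (rule measurableI)
      fix C :: "ennreal set" assume C: "C \<in> sets borel"
      have "(\<lambda>\<xi>. num_points \<xi> B) -` C \<inter> configurations \<in> sigma_sets configurations ?G"
        using B C by (intro sigma_sets.Basic) auto
      then show "(\<lambda>\<xi>. num_points \<xi> B) -` C \<inter> space configuration_space \<in> sets configuration_space"
        unfolding configuration_space_def by (subst sets_measure_of) (auto simp: space_measure_of_conv)
    qed simp
    then show ?thesis by measurable
  qed
  have "num_points (N \<omega>) A = (SUP m. num_points (N \<omega>) (A \<inter> window m))" for \<omega>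
  proof -
    have "(SUP m. num_points (N \<omega>) (A \<inter> window m)) = emeasure (count_space UNIV) (\<Union>m. N \<omega> \<inter> (A \<inter> window m))"
      unfolding num_points_def using window_mono by (intro SUP_emeasure_incseq) (auto simp: incseq_def)
    also have "(\<Union>m. N \<omega> \<inter> (A \<inter> window m)) = N \<omega> \<inter> A" using Union_window by auto
    finally show ?thesis by (simp add: num_points_def)
  qed
  moreover have "(\<lambda>\<omega>. num_points (N \<omega>) (A \<inter> window m)) \<in> borel_measurable M" for m
    using bounded_window by (intro bdd) (auto intro: bounded_subset)
  ultimately show ?thesis by simp
qed

lemma num_points_null: "A \<in> sets borel \<Longrightarrow> emeasure \<mu> A = 0 \<Longrightarrow> AE \<omega> in M. num_points (N \<omega>) A = 0"
  using process by (simp add: T_point_process_def)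

lemma moment_finite:
  assumes "A \<in> sets borel" "emeasure \<mu> A < \<infinity>"
  shows "(\<integral>\<^sup>+\<omega>. num_points (N \<omega>) A ^ n \<partial>M) < \<infinity>"
proof (cases "n = 0")
  case False
  show ?thesis
  proof (cases "emeasure \<mu> A = 0")
    case True
    have "(\<integral>\<^sup>+\<omega>. num_points (N \<omega>) A ^ n \<partial>M) = (\<integral>\<^sup>+\<omega>. 0 \<partial>M)"
      using num_points_null[OF assms(1) True] False by (intro nn_integral_cong_AE) (auto simp: power_0_left)
    then show ?thesis by simp
  next
    case nz: False
    then have "A \<in> finite_pos_sets \<mu>"
      using assms by (auto simp: finite_pos_sets_def zero_less_iff_neq_zero)
    then show ?thesis using moments \<open>n \<noteq> 0\<close> unfolding moments_of_all_orders_def by simp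
  qed
qed (simp add: emeasure_space_1)

lemma AE_finite_points:
  assumes [measurable]: "A \<in> sets borel" and "emeasure \<mu> A < \<infinity>"
  shows "AE \<omega> in M. finite (N \<omega> \<inter> A)"
proof -
  have "AE \<omega> in M. num_points (N \<omega>) A \<noteq> \<infinity>"
    using moment_finite[of A 1] assms by (intro nn_integral_PInf_AE) auto
  then show ?thesis by eventually_elim (auto simp: num_points_def emeasure_count_space split: if_splits)
qed

text \<open>Apply the equivariance of the counts to singletons.\<close>

lemma AE_N_equivariant: "AE \<omega> in M. N (S \<omega>) = T ` N \<omega>"
proof -
  have "AE \<omega> in M. \<forall>A\<in>sets \<mu>. num_points (N (S \<omega>)) A = num_points (N \<omega>) (T -` A)"
    using process by (simp add: T_point_process_def)
  then show ?thesis
  proof eventually_elim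
    case (elim \<omega>)
    have mem: "x \<in> \<xi> \<longleftrightarrow> num_points \<xi> {x} \<noteq> 0" for x :: 'a and \<xi>
      by (auto simp: num_points_def emeasure_count_space_eq_0)
    have "y \<in> N (S \<omega>) \<longleftrightarrow> y \<in> T ` N \<omega>" for y
    proof -
      have "T -` {y} = {inv T y}" using bij_T
        by (metis bij_betw_def bij_imp_bij_inv bij_vimage_eq_inv_image image_empty image_insert)
      moreover have "num_points (N (S \<omega>)) {y} = num_points (N \<omega>) (T -` {y})" using elim by simp
      ultimately have "y \<in> N (S \<omega>) \<longleftrightarrow> inv T y \<in> N \<omega>" using mem by metis
      also have "\<dots> \<longleftrightarrow> y \<in> T ` N \<omega>"
        using bij_T by (metis bij_inv_eq_iff image_iff)
      finally show ?thesis .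
    qed
    then show ?case by blast
  qed
qed

abbreviation product_space :: "nat \<Rightarrow> (nat \<Rightarrow> 'a) measure" where
  "product_space n \<equiv> Pi\<^sub>M {1..n} (\<lambda>_. \<mu>)"

lemma measurable_coordinate [measurable]:
  "i \<in> {1..n} \<Longrightarrow> (\<lambda>x. x i) \<in> borel_measurable (product_space n)"
  using measurable_component_singleton[of i "{1..n}" "\<lambda>_. \<mu>"]
  by (simp cong: measurable_cong_sets)

definition tuples :: "nat \<Rightarrow> 'w \<Rightarrow> (nat \<Rightarrow> 'a) set \<Rightarrow> ennreal" where
  "tuples n \<omega> A = emeasure (count_space UNIV) (Pi\<^sub>E {1..n} (\<lambda>_. N \<omega>) \<inter> A)"

text \<open>For a rectangle inside a bounded window the number of tuples is a product of counts, and the windows make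
all numbers finite, which the complements in Dynkin's theorem require; then let the windows grow.\<close>

lemma measurable_tuples [measurable]:
  assumes "A \<in> sets (product_space n)"
  shows "(\<lambda>\<omega>. tuples n \<omega> A) \<in> borel_measurable M"
proof -
  let ?G = "{Pi\<^sub>E {1..n} X | X. \<forall>i\<in>{1..n}. X i \<in> sets \<mu>}"
  let ?\<Omega> = "Pi\<^sub>E {1..n} (\<lambda>_. UNIV :: 'a set)"
  have sets_eq: "sets (product_space n) = sigma_sets ?\<Omega> ?G"
  proof -
    have "prod_algebra {1..n} (\<lambda>_. \<mu>) = ?G" by (subst prod_algebra_eq_finite) (auto simp: Pi_iff)
    then show ?thesis using sets_PiM[of "{1..n}" "\<lambda>_. \<mu>"] by simp
  qed
  define L where "L m \<omega> A = tuples n \<omega> (A \<inter> Pi\<^sub>E {1..n} (\<lambda>_. window m))" for m \<omega> A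
  have L_eq: "L m \<omega> A = emeasure (count_space UNIV) (Pi\<^sub>E {1..n} (\<lambda>_. N \<omega> \<inter> window m) \<inter> A)" for m \<omega> A
  proof -
    have "Pi\<^sub>E {1..n} (\<lambda>_. N \<omega>) \<inter> (A \<inter> Pi\<^sub>E {1..n} (\<lambda>_. window m)) = Pi\<^sub>E {1..n} (\<lambda>_. N \<omega> \<inter> window m) \<inter> A"
      unfolding PiE_Int[symmetric] by auto
    then show ?thesis by (simp add: L_def tuples_def)
  qed
  have fin: "finite (Pi\<^sub>E {1..n} (\<lambda>_. N \<omega> \<inter> window m))" if "\<omega> \<in> space M" for m \<omega>
    using finite_points_window[OF that] by (intro finite_PiE) auto
  have rect: "(\<lambda>\<omega>. L m \<omega> (Pi\<^sub>E {1..n} X)) \<in> borel_measurable M"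
    if [measurable]: "\<forall>i\<in>{1..n}. X i \<in> sets \<mu>" for m X
  proof -
    have "L m \<omega> (Pi\<^sub>E {1..n} X) = (\<Prod>i\<in>{1..n}. num_points (N \<omega>) (window m \<inter> X i))" if w: "\<omega> \<in> space M" for \<omega>
    proof -
      have f: "finite (N \<omega> \<inter> (window m \<inter> X i))" for i
        by (rule finite_subset[OF _ finite_points_window[OF w, of m]]) auto
      have "Pi\<^sub>E {1..n} (\<lambda>_. N \<omega> \<inter> window m) \<inter> Pi\<^sub>E {1..n} X = Pi\<^sub>E {1..n} (\<lambda>i. N \<omega> \<inter> (window m \<inter> X i))"
        unfolding PiE_Int by (simp add: Int_assoc)
      moreover have "finite (Pi\<^sub>E {1..n} (\<lambda>i. N \<omega> \<inter> (window m \<inter> X i)))" using f by (intro finite_PiE) auto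
      ultimately show ?thesis
        unfolding L_eq num_points_def using f by (simp add: card_PiE)
    qed
    moreover have "(\<lambda>\<omega>. \<Prod>i\<in>{1..n}. num_points (N \<omega>) (window m \<inter> X i)) \<in> borel_measurable M"
      using that by (intro borel_measurable_prod_ennreal measurable_num_points) auto
    ultimately show ?thesis by (subst measurable_cong) auto
  qed
  have full: "(\<lambda>\<omega>. L m \<omega> ?\<Omega>) \<in> borel_measurable M" for m by (rule rect) simp
  have "(\<lambda>\<omega>. L m \<omega> A) \<in> borel_measurable M" for m
  proof (rule sigma_sets_induct_disjoint[of ?G ?\<Omega> A])
    show "Int_stable ?G" by (rule Int_stable_PiE)
    show "A \<in> sigma_sets ?\<Omega> ?G" using assms sets_eq by simp
    show "(\<lambda>\<omega>. L m \<omega> (?\<Omega> - B)) \<in> borel_measurable M"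
      if "B \<in> sigma_sets ?\<Omega> ?G" "(\<lambda>\<omega>. L m \<omega> B) \<in> borel_measurable M" for B
    proof -
      have sub: "B \<subseteq> ?\<Omega>" using that(1) sets_eq sets.sets_into_space[of B "product_space n"]
        by (auto simp: space_PiM)
      have "L m \<omega> (?\<Omega> - B) = L m \<omega> ?\<Omega> - L m \<omega> B" if w: "\<omega> \<in> space M" for \<omega>
      proof -
        have "Pi\<^sub>E {1..n} (\<lambda>_. N \<omega> \<inter> window m) \<inter> (?\<Omega> - B) =
            (Pi\<^sub>E {1..n} (\<lambda>_. N \<omega> \<inter> window m) \<inter> ?\<Omega>) - (Pi\<^sub>E {1..n} (\<lambda>_. N \<omega> \<inter> window m) \<inter> B)" by auto
        then show ?thesis unfolding L_eq using fin[OF w, of m] sub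
          by (simp only:) (intro emeasure_Diff; auto simp: emeasure_count_space)
      qed
      moreover have "(\<lambda>\<omega>. L m \<omega> ?\<Omega> - L m \<omega> B) \<in> borel_measurable M"
        using full[of m] that(2) by (rule borel_measurable_minus_ennreal)
      ultimately show ?thesis by (subst measurable_cong) auto
    qed
    show "(\<lambda>\<omega>. L m \<omega> (\<Union>i. B i)) \<in> borel_measurable M"
      if "disjoint_family B" "range B \<subseteq> sigma_sets ?\<Omega> ?G" "\<And>i. (\<lambda>\<omega>. L m \<omega> (B i)) \<in> borel_measurable M"
      for B :: "nat \<Rightarrow> _"
    proof -
      have "L m \<omega> (\<Union>i. B i) = (\<Sum>i. L m \<omega> (B i))" for \<omega>
      proof -
        have "(\<Sum>i. L m \<omega> (B i)) = emeasure (count_space UNIV) (\<Union>i. Pi\<^sub>E {1..n} (\<lambda>_. N \<omega> \<inter> window m) \<inter> B i)"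
          unfolding L_eq using that(1) by (intro suminf_emeasure) (auto simp: disjoint_family_on_def)
        then show ?thesis by (simp add: L_eq)
      qed
      then show ?thesis using that(3) by simp
    qed
    show "(\<lambda>\<omega>. L m \<omega> {}) \<in> borel_measurable M" by (simp add: L_eq)
  qed (use rect in auto)
  moreover have "tuples n \<omega> A = (SUP m. L m \<omega> A)" for \<omega>
  proof -
    have "(\<Union>m. Pi\<^sub>E {1..n} (\<lambda>_. N \<omega>) \<inter> (A \<inter> Pi\<^sub>E {1..n} (\<lambda>_. window m))) = Pi\<^sub>E {1..n} (\<lambda>_. N \<omega>) \<inter> A"
    proof -
      have "\<exists>m. x \<in> Pi\<^sub>E {1..n} (\<lambda>_. window m)" if x: "x \<in> Pi\<^sub>E {1..n} (\<lambda>_. N \<omega>)" for x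
      proof -
        have "\<exists>m. x ` {1..n} \<subseteq> window m" by (intro bounded_subset_window finite_imp_bounded) simp
        then show ?thesis using x by (auto simp: PiE_iff)
      qed
      then show ?thesis by blast
    qed
    moreover have "(SUP m. L m \<omega> A) = emeasure (count_space UNIV) (\<Union>m. Pi\<^sub>E {1..n} (\<lambda>_. N \<omega>) \<inter> (A \<inter> Pi\<^sub>E {1..n} (\<lambda>_. window m)))"
    proof -
      have "Pi\<^sub>E {1..n} (\<lambda>_. window m) \<subseteq> Pi\<^sub>E {1..n} (\<lambda>_. window m')" if "m \<le> m'" for m m'
        using window_mono[OF that] by (intro PiE_mono) auto
      then show ?thesis
        unfolding L_def tuples_def by (intro SUP_emeasure_incseq) (auto simp: incseq_def)
    qed
    ultimately show ?thesis by (simp add: tuples_def)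
  qed
  ultimately show ?thesis by simp
qed

definition distinct_tuples :: "nat \<Rightarrow> (nat \<Rightarrow> 'a) set" where
  "distinct_tuples n = {x \<in> space (product_space n). inj_on x {1..n}}"

lemma distinct_tuples [measurable]: "distinct_tuples n \<in> sets (product_space n)"
proof -
  have "distinct_tuples n =
    {x \<in> space (product_space n). \<forall>i\<in>{1..n}. \<forall>j\<in>{1..n}. x i = x j \<longrightarrow> i = j}"
    by (auto simp: distinct_tuples_def inj_on_def)
  also have "\<dots> \<in> sets (product_space n)"
  proof (intro sets.sets_Collect_finite_All sets.sets_Collect_imp)
    fix i j assume "i \<in> {1..n}" "j \<in> {1..n}"
    then show "{x \<in> space (product_space n). x i = x j} \<in> sets (product_space n)"
      by (intro measurable_equality_set measurable_coordinate)
  qed auto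
  finally show ?thesis .
qed

definition factorial_moment_measure :: "nat \<Rightarrow> (nat \<Rightarrow> 'a) measure" where
  "factorial_moment_measure n = measure_of (space (product_space n)) (sets (product_space n))
     (\<lambda>A. \<integral>\<^sup>+\<omega>. tuples n \<omega> (A \<inter> distinct_tuples n) \<partial>M)"

lemma sets_factorial_moment_measure [simp, measurable_cong]:
  "sets (factorial_moment_measure n) = sets (product_space n)"
  by (simp add: factorial_moment_measure_def)

lemma space_factorial_moment_measure [simp]:
  "space (factorial_moment_measure n) = space (product_space n)"
  by (rule sets_eq_imp_space_eq) simp

lemma emeasure_factorial_moment_measure:
  assumes "A \<in> sets (product_space n)"
  shows "emeasure (factorial_moment_measure n) A = (\<integral>\<^sup>+\<omega>. tuples n \<omega> (A \<inter> distinct_tuples n) \<partial>M)"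
  unfolding factorial_moment_measure_def
proof (rule emeasure_measure_of_sigma)
  show "sigma_algebra (space (product_space n)) (sets (product_space n))" ..
  show "positive (sets (product_space n)) (\<lambda>A. \<integral>\<^sup>+\<omega>. tuples n \<omega> (A \<inter> distinct_tuples n) \<partial>M)"
    by (simp add: positive_def tuples_def)
  show "countably_additive (sets (product_space n)) (\<lambda>A. \<integral>\<^sup>+\<omega>. tuples n \<omega> (A \<inter> distinct_tuples n) \<partial>M)"
  proof (rule countably_additiveI)
    fix B :: "nat \<Rightarrow> (nat \<Rightarrow> 'a) set"
    assume B: "range B \<subseteq> sets (product_space n)" "disjoint_family B"
    have "tuples n \<omega> ((\<Union>i. B i) \<inter> distinct_tuples n) = (\<Sum>i. tuples n \<omega> (B i \<inter> distinct_tuples n))" for \<omega>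
    proof -
      have "(\<Sum>i. tuples n \<omega> (B i \<inter> distinct_tuples n)) =
          emeasure (count_space UNIV) (\<Union>i. Pi\<^sub>E {1..n} (\<lambda>_. N \<omega>) \<inter> (B i \<inter> distinct_tuples n))"
        unfolding tuples_def using B(2) by (intro suminf_emeasure) (auto simp: disjoint_family_on_def)
      also have "(\<Union>i. Pi\<^sub>E {1..n} (\<lambda>_. N \<omega>) \<inter> (B i \<inter> distinct_tuples n)) =
          Pi\<^sub>E {1..n} (\<lambda>_. N \<omega>) \<inter> ((\<Union>i. B i) \<inter> distinct_tuples n)" by auto
      finally show ?thesis by (simp add: tuples_def)
    qed
    moreover have "(\<integral>\<^sup>+\<omega>. (\<Sum>i. tuples n \<omega> (B i \<inter> distinct_tuples n)) \<partial>M) =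
        (\<Sum>i. \<integral>\<^sup>+\<omega>. tuples n \<omega> (B i \<inter> distinct_tuples n) \<partial>M)"
      using B(1) by (intro nn_integral_suminf measurable_tuples sets.Int distinct_tuples) blast
    ultimately show "(\<Sum>i. \<integral>\<^sup>+\<omega>. tuples n \<omega> (B i \<inter> distinct_tuples n) \<partial>M) =
        (\<integral>\<^sup>+\<omega>. tuples n \<omega> ((\<Union>i. B i) \<inter> distinct_tuples n) \<partial>M)" by simp
  qed
qed fact

end

text \<open>Keeps the index set in the form \<open>{1..n}\<close> under simplification.\<close>

declare One_nat_def [simp del]

context invariant_point_process
begin

lemma measurable_product_map [measurable]:
  "product_map n T \<in> measurable (product_space n) (product_space n)"
proof -
  have "(\<lambda>x. T (x i)) \<in> measurable (product_space n) \<mu>" if "i \<in> {1..n}" for i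
  proof -
    have "(\<lambda>x. T (x i)) \<in> borel_measurable (product_space n)"
      using measurable_coordinate[OF that] by measurable
    then show ?thesis by (simp cong: measurable_cong_sets)
  qed
  then show ?thesis unfolding product_map_def[abs_def] by (intro measurable_restrict)
qed

lemma inv_T_T [simp]: "inv T (T x) = x" and T_inv_T [simp]: "T (inv T x) = x"
  using bij_T by (simp_all add: bij_is_inj bij_is_surj surj_f_inv_f)

text \<open>The map \<open>T \<times> \<dots> \<times> T\<close> sends the tuples of \<open>N \<omega>\<close> bijectively to those of \<open>N (S \<omega>)\<close>.\<close>

lemma tuples_shift:
  assumes "N (S \<omega>) = T ` N \<omega>" "A \<subseteq> space (product_space n)"
  shows "tuples n (S \<omega>) A = tuples n \<omega> (product_map n T -` A \<inter> space (product_space n))"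
proof -
  let ?P = "space (product_space n)"
  have left_inv: "product_map n (inv T) (product_map n T x) = x" if "x \<in> ?P" for x
    using that by (auto simp: product_map_def space_PiM PiE_iff extensional_def fun_eq_iff)
  have right_inv: "product_map n T (product_map n (inv T) y) = y" if "y \<in> ?P" for y
    using that by (auto simp: product_map_def space_PiM PiE_iff extensional_def fun_eq_iff)
  have mem: "product_map n T x \<in> Pi\<^sub>E {1..n} (\<lambda>_. T ` N \<omega>)" if "x \<in> Pi\<^sub>E {1..n} (\<lambda>_. N \<omega>)" for x
    using that by (auto simp: product_map_def)
  have mem': "product_map n (inv T) y \<in> Pi\<^sub>E {1..n} (\<lambda>_. N \<omega>)" if "y \<in> Pi\<^sub>E {1..n} (\<lambda>_. T ` N \<omega>)" for y
    using that by (force simp: product_map_def PiE_iff)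
  have sp: "product_map n f x \<in> ?P" for f x
    by (auto simp: product_map_def space_PiM)
  have "bij_betw (product_map n T) (Pi\<^sub>E {1..n} (\<lambda>_. N \<omega>) \<inter> (product_map n T -` A \<inter> ?P))
     (Pi\<^sub>E {1..n} (\<lambda>_. N (S \<omega>)) \<inter> A)"
    unfolding assms(1)
  proof (rule bij_betwI[where g = "product_map n (inv T)"])
    show "product_map n (inv T) \<in> Pi\<^sub>E {1..n} (\<lambda>_. T ` N \<omega>) \<inter> A \<rightarrow>
        Pi\<^sub>E {1..n} (\<lambda>_. N \<omega>) \<inter> (product_map n T -` A \<inter> ?P)"
    proof
      fix y assume y: "y \<in> Pi\<^sub>E {1..n} (\<lambda>_. T ` N \<omega>) \<inter> A"
      then have "product_map n T (product_map n (inv T) y) \<in> A" using right_inv[of y] assms(2) by auto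
      then show "product_map n (inv T) y \<in> Pi\<^sub>E {1..n} (\<lambda>_. N \<omega>) \<inter> (product_map n T -` A \<inter> ?P)"
        using mem'[of y] y sp by simp
    qed
  qed (use mem left_inv right_inv assms(2) in auto)
  then show ?thesis unfolding tuples_def by (rule emeasure_count_space_bij[symmetric])
qed

lemma factorial_moment_measure_invariant:
  "distr (factorial_moment_measure n) (factorial_moment_measure n) (product_map n T) = factorial_moment_measure n"
proof (rule measure_eqI)
  let ?pm = "product_map n T" and ?P = "product_space n"
  fix A assume "A \<in> sets (distr (factorial_moment_measure n) (factorial_moment_measure n) ?pm)"
  then have A: "A \<in> sets ?P" by simp
  then have sub: "A \<inter> distinct_tuples n \<subseteq> space ?P" using sets.sets_into_space by blast
  have pre: "?pm -` A \<inter> space ?P \<in> sets ?P" using A by measurable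
  have D: "?pm -` (A \<inter> distinct_tuples n) \<inter> space ?P = ?pm -` A \<inter> space ?P \<inter> distinct_tuples n"
  proof -
    have "inj_on (?pm x) {1..n} \<longleftrightarrow> inj_on x {1..n}" for x
    proof -
      have "inj_on (?pm x) {1..n} \<longleftrightarrow> inj_on (\<lambda>i. T (x i)) {1..n}"
        by (rule inj_on_cong) (simp add: product_map_def)
      also have "\<dots> \<longleftrightarrow> inj_on x {1..n}"
        unfolding inj_on_def inj_eq[OF bij_is_inj[OF bij_T]] ..
      finally show ?thesis .
    qed
    moreover have "?pm x \<in> space ?P" for x
      by (auto simp: product_map_def space_PiM)
    ultimately show ?thesis by (auto simp: distinct_tuples_def)
  qed
  have "emeasure (distr (factorial_moment_measure n) (factorial_moment_measure n) ?pm) A =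
      emeasure (factorial_moment_measure n) (?pm -` A \<inter> space ?P)"
    using A by (subst emeasure_distr) (simp_all cong: measurable_cong_sets)
  also have "\<dots> = (\<integral>\<^sup>+\<omega>. tuples n \<omega> (?pm -` (A \<inter> distinct_tuples n) \<inter> space ?P) \<partial>M)"
    unfolding D by (rule emeasure_factorial_moment_measure[OF pre])
  also have "\<dots> = (\<integral>\<^sup>+\<omega>. tuples n (S \<omega>) (A \<inter> distinct_tuples n) \<partial>M)"
    using AE_N_equivariant by (intro nn_integral_cong_AE) (auto simp: tuples_shift[OF _ sub])
  also have "\<dots> = (\<integral>\<^sup>+\<omega>. tuples n \<omega> (A \<inter> distinct_tuples n) \<partial>distr M M S)"
    using A by (subst nn_integral_distr) auto
  also have "\<dots> = emeasure (factorial_moment_measure n) A"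
    using A by (simp only: distr_S emeasure_factorial_moment_measure)
  finally show "emeasure (distr (factorial_moment_measure n) (factorial_moment_measure n) ?pm) A =
    emeasure (factorial_moment_measure n) A" .
qed simp

lemma factorial_moment_measure_boundedly_finite:
  "boundedly_finite_prod n (factorial_moment_measure n)"
  unfolding boundedly_finite_prod_def
proof (intro ballI impI)
  fix A assume A: "A \<in> sets (factorial_moment_measure n)" "\<forall>i\<in>{1..n}. bounded ((\<lambda>x. x i) ` A)"
  have "bounded (\<Union>i\<in>{1..n}. (\<lambda>x. x i) ` A)" using A(2) by (intro bounded_UN) auto
  then obtain m where m: "(\<Union>i\<in>{1..n}. (\<lambda>x. x i) ` A) \<subseteq> window m" using bounded_subset_window by blast
  have "emeasure (factorial_moment_measure n) A = (\<integral>\<^sup>+\<omega>. tuples n \<omega> (A \<inter> distinct_tuples n) \<partial>M)"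
    using A(1) by (simp add: emeasure_factorial_moment_measure)
  also have "\<dots> \<le> (\<integral>\<^sup>+\<omega>. num_points (N \<omega>) (window m) ^ n \<partial>M)"
  proof (rule nn_integral_mono)
    fix \<omega> assume w: "\<omega> \<in> space M"
    have "Pi\<^sub>E {1..n} (\<lambda>_. N \<omega>) \<inter> (A \<inter> distinct_tuples n) \<subseteq> Pi\<^sub>E {1..n} (\<lambda>_. N \<omega> \<inter> window m)"
      using m by (auto simp: PiE_iff)
    then have "tuples n \<omega> (A \<inter> distinct_tuples n) \<le>
        emeasure (count_space UNIV) (Pi\<^sub>E {1..n} (\<lambda>_. N \<omega> \<inter> window m))"
      unfolding tuples_def by (intro emeasure_mono) auto
    also have "\<dots> = num_points (N \<omega>) (window m) ^ n"
      using finite_points_window[OF w, of m]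
      by (subst emeasure_count_space_finite) (auto intro!: finite_PiE simp: num_points_def card_PiE)
    finally show "tuples n \<omega> (A \<inter> distinct_tuples n) \<le> num_points (N \<omega>) (window m) ^ n" .
  qed
  also have "\<dots> < \<infinity>" using window window_finite by (rule moment_finite)
  finally show "emeasure (factorial_moment_measure n) A < \<infinity>" .
qed

lemma factorial_moment_measure_marginal:
  assumes i: "i \<in> {1..n}"
  shows "absolutely_continuous \<mu> (distr (factorial_moment_measure n) \<mu> (\<lambda>x. x i))"
  unfolding absolutely_continuous_def
proof
  let ?P = "product_space n"
  fix A assume A: "A \<in> null_sets \<mu>"
  then have [measurable]: "A \<in> sets borel" and A0: "emeasure \<mu> A = 0" by auto
  have m: "(\<lambda>x. x i) \<in> measurable (factorial_moment_measure n) \<mu>"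
    using measurable_coordinate[OF i] by (simp cong: measurable_cong_sets)
  have pre: "(\<lambda>x. x i) -` A \<inter> space ?P \<in> sets ?P"
    using measurable_sets[OF m, of A] by simp
  have "emeasure (factorial_moment_measure n) ((\<lambda>x. x i) -` A \<inter> space ?P) = (\<integral>\<^sup>+\<omega>. 0 \<partial>M)"
    unfolding emeasure_factorial_moment_measure[OF pre]
  proof (rule nn_integral_cong_AE)
    show "AE \<omega> in M. tuples n \<omega> ((\<lambda>x. x i) -` A \<inter> space ?P \<inter> distinct_tuples n) = 0"
      using num_points_null[OF _ A0]
    proof (rule AE_mp)
      have "num_points (N \<omega>) A = 0 \<Longrightarrow> tuples n \<omega> ((\<lambda>x. x i) -` A \<inter> space ?P \<inter> distinct_tuples n) = 0" for \<omega>
        using i unfolding num_points_def tuples_def by (auto simp: emeasure_count_space_eq_0 PiE_iff)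
      then show "AE \<omega> in M. num_points (N \<omega>) A = 0 \<longrightarrow>
          tuples n \<omega> ((\<lambda>x. x i) -` A \<inter> space ?P \<inter> distinct_tuples n) = 0" by auto
    qed simp
  qed
  then show "A \<in> null_sets (distr (factorial_moment_measure n) \<mu> (\<lambda>x. x i))"
    by (simp add: null_sets_def emeasure_distr[OF m])
qed

section \<open>Freeness and the ergodic components\<close>

lemma AE_N_funpow: "AE \<omega> in M. \<forall>k. N ((S ^^ k) \<omega>) = (T ^^ k) ` N \<omega>"
proof -
  have "AE \<omega> in M. N ((S ^^ k) \<omega>) = (T ^^ k) ` N \<omega>" for k
  proof (induction k)
    case (Suc k)
    from AE_S[OF Suc] AE_N_equivariant show ?case
      by eventually_elim (simp add: funpow_swap1 image_comp funpow_Suc_right del: funpow.simps)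
  qed simp
  then show ?thesis by (simp add: AE_all_countable)
qed

lemma measurable_int_iterate [measurable]: "int_iterate UNIV T k \<in> borel_measurable borel"
proof -
  have "(T ^^ m) \<in> borel_measurable borel" "(inv T ^^ m) \<in> borel_measurable borel" for m
    by (induction m) auto
  then show ?thesis by (simp add: int_iterate_def)
qed

definition same_orbit :: "nat \<Rightarrow> nat \<Rightarrow> nat \<Rightarrow> int \<Rightarrow> (nat \<Rightarrow> 'a) set" where
  "same_orbit n i j k = {x \<in> space (product_space n). x j = int_iterate UNIV T k (x i)}"

lemma same_orbit [measurable]:
  assumes "i \<in> {1..n}" "j \<in> {1..n}"
  shows "same_orbit n i j k \<in> sets (product_space n)"
  unfolding same_orbit_def
  by (intro measurable_equality_set measurable_coordinate assms
        measurable_compose[OF measurable_coordinate[OF assms(1)] measurable_int_iterate])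

text \<open>The complement of the orbit relation is covered by countably many rectangles, obtained from pairs of disjoint
basic open sets \<open>U\<close>, \<open>V\<close>: the coordinate \<open>Min P\<close> is sent into \<open>U\<close> by the power \<open>\<kappa> j\<close> of \<open>T\<close>, and the coordinate \<open>j\<close> lies in \<open>V\<close>.  On
each of them the factor of \<open>m\<close> that belongs to the block \<open>P\<close> is the measure of the empty set.\<close>

lemma m_measure_concentrated:
  assumes m: "is_m_measure \<mu> T n \<pi> \<kappa> m" and \<pi>: "partition_on {1..n} \<pi>" "pi_compatible \<pi> \<kappa>"
    and P: "P \<in> \<pi>" "j \<in> P"
  shows "emeasure m (space (product_space n) - same_orbit n (Min P) j (\<kappa> j)) = 0"
proof (cases "j = Min P")
  case True
  then have "\<kappa> j = 0" using \<pi>(2) P by (simp add: pi_compatible_def)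
  then have "same_orbit n (Min P) j (\<kappa> j) = space (product_space n)"
    using True by (simp add: same_orbit_def int_iterate_def)
  then show ?thesis by simp
next
  case False
  let ?i = "Min P" and ?g = "int_iterate UNIV T (\<kappa> j)"
  have Psub: "P \<subseteq> {1..n}" using \<pi>(1) P by (auto simp: partition_on_def)
  then have i: "?i \<in> P" using P by (auto intro!: Min_in intro: finite_subset)
  have \<kappa>i: "\<kappa> ?i = 0" using \<pi>(2) P by (simp add: pi_compatible_def)
  have sm: "sets m = sets (product_space n)" using m by (simp add: is_m_measure_def)
  have fin\<pi>: "finite \<pi>" using \<pi>(1) finite_elements by blast
  obtain B :: "'a set set" where B: "countable B" "topological_basis B" using ex_countable_basis by blast
  define R where "R = (\<lambda>(U, V). Pi\<^sub>E {1..n} (\<lambda>l. if l = ?i then ?g -` U else if l = j then V else UNIV))"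
  let ?I = "{(U, V). U \<in> B \<and> V \<in> B \<and> U \<inter> V = {}}"
  have cI: "countable ?I" by (rule countable_subset[of _ "B \<times> B"]) (use B in auto)
  have null: "R p \<in> null_sets m" if "p \<in> ?I" for p
  proof -
    obtain U V where p: "p = (U, V)" and UV: "U \<in> B" "V \<in> B" "U \<inter> V = {}" using \<open>p \<in> ?I\<close> by blast
    have bor: "U \<in> sets borel" "V \<in> sets borel"
      using UV topological_basis_open[OF B(2)] by (auto intro: borel_open)
    let ?A = "\<lambda>l. if l = ?i then ?g -` U else if l = j then V else UNIV"
    have gU: "?g -` U \<in> sets borel" using measurable_sets[OF measurable_int_iterate bor(1)] by simp
    then have A: "\<forall>l\<in>{1..n}. ?A l \<in> sets \<mu>" using bor by auto
    then have "R p \<in> sets m" unfolding sm R_def p by (auto intro!: sets_PiM_I_finite)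
    moreover have "emeasure m (R p) = (\<Prod>P\<in>\<pi>. emeasure \<mu> (\<Inter>i\<in>P. int_iterate (space \<mu>) T (\<kappa> i) -` ?A i))"
      using m A unfolding is_m_measure_def R_def p by (simp del: space_\<mu>)
    moreover
    have "(\<Inter>i\<in>P. int_iterate (space \<mu>) T (\<kappa> i) -` ?A i) = {}"
    proof -
      have "False" if x: "\<forall>l\<in>P. int_iterate UNIV T (\<kappa> l) x \<in> ?A l" for x
      proof -
        have "x \<in> ?g -` U" using x[rule_format, OF i] \<kappa>i by (simp add: int_iterate_def)
        moreover have "?g x \<in> V" using x[rule_format, OF P(2)] False by simp
        ultimately show False using UV by auto
      qed
      then show ?thesis unfolding space_\<mu> by auto
    qed
    then have "emeasure \<mu> (\<Inter>i\<in>P. int_iterate (space \<mu>) T (\<kappa> i) -` ?A i) = 0" by simp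
    then have "(\<Prod>P\<in>\<pi>. emeasure \<mu> (\<Inter>i\<in>P. int_iterate (space \<mu>) T (\<kappa> i) -` ?A i)) = 0"
      using P(1) by (intro prod_zero fin\<pi>) (rule bexI)
    ultimately have "emeasure m (R p) = 0" by simp
    then show ?thesis using \<open>R p \<in> sets m\<close> by auto
  qed
  have "space (product_space n) - same_orbit n ?i j (\<kappa> j) \<subseteq> (\<Union>p\<in>?I. R p)"
  proof
    fix x assume x: "x \<in> space (product_space n) - same_orbit n ?i j (\<kappa> j)"
    then have "?g (x ?i) \<noteq> x j" by (auto simp: same_orbit_def)
    from hausdorff[OF this] obtain U V where UV: "open U" "open V" "?g (x ?i) \<in> U" "x j \<in> V" "U \<inter> V = {}"
      by blast
    obtain U' where U': "U' \<in> B" "?g (x ?i) \<in> U'" "U' \<subseteq> U" using B(2) UV topological_basisE by metis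
    obtain V' where V': "V' \<in> B" "x j \<in> V'" "V' \<subseteq> V" using B(2) UV topological_basisE by metis
    have "x \<in> R (U', V')" using x U' V' False by (auto simp: R_def PiE_iff space_PiM)
    moreover have "(U', V') \<in> ?I" using U' V' UV by auto
    ultimately show "x \<in> (\<Union>p\<in>?I. R p)" by blast
  qed
  moreover have "(\<Union>p\<in>?I. R p) \<in> null_sets m" using null cI by (intro null_sets_UN')
  ultimately show ?thesis by (intro emeasure_eq_0[OF null_setsD2 null_setsD1])
qed

lemma m_measure_singletons:
  assumes m: "is_m_measure \<mu> T n \<pi> \<kappa> m" and \<pi>: "\<pi> = (\<lambda>i. {i}) ` {1..n}" "pi_compatible \<pi> \<kappa>"
    and A: "\<And>i. i \<in> {1..n} \<Longrightarrow> A i \<in> sets borel"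
  shows "emeasure m (Pi\<^sub>E {1..n} A) = (\<Prod>i\<in>{1..n}. emeasure \<mu> (A i))"
proof -
  have "\<kappa> i = 0" if "i \<in> {1..n}" for i using \<pi> that by (auto simp: pi_compatible_def)
  moreover have "emeasure m (Pi\<^sub>E {1..n} A) =
      (\<Prod>P\<in>\<pi>. emeasure \<mu> (\<Inter>i\<in>P. int_iterate (space \<mu>) T (\<kappa> i) -` A i))"
    using m A unfolding is_m_measure_def by (simp del: space_\<mu>)
  ultimately show ?thesis unfolding \<pi>(1) by (subst (asm) prod.reindex) (auto simp: int_iterate_def)
qed

end

locale free_point_process = invariant_point_process +
  assumes P2: "property_P2 \<mu> T" and ergodic_S: "ergodic M S" and free: "free_process M S N"
begin

text \<open>For \<open>k > 0\<close> two such points \<open>y\<close> and \<open>T\<^sup>k y\<close> of \<open>N \<omega>\<close> would make \<open>T\<^sup>k y\<close> a common point of \<open>N \<omega>\<close> and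
\<open>N (S\<^sup>k \<omega>) = T\<^sup>k (N \<omega>)\<close>.  For \<open>k < 0\<close> the two points exchange their roles, and \<open>k = 0\<close> is excluded by
distinctness.\<close>

lemma factorial_moment_measure_same_orbit:
  assumes ij: "i \<in> {1..n}" "j \<in> {1..n}" "i \<noteq> j"
  shows "emeasure (factorial_moment_measure n) (same_orbit n i j k) = 0"
proof -
  have free': "AE \<omega> in M. \<forall>k::int. k \<noteq> 0 \<longrightarrow> N \<omega> \<inter> N (int_iterate (space M) S k \<omega>) = {}"
    using free by (simp add: free_process_def)
  \<comment> \<open>Almost surely there is no such tuple of distinct points, for any \<open>\<omega>\<close> at which freeness and equivariance hold.\<close>
  have empty: "AE \<omega> in M. tuples n \<omega> (same_orbit n i j k \<inter> distinct_tuples n) = 0"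
    using free' AE_N_funpow
  proof eventually_elim
    case (elim \<omega>)
    have disj: "(T ^^ l) y \<notin> N \<omega>" if "l > 0" "y \<in> N \<omega>" for l y
      using elim(1)[rule_format, of "int l"] elim(2) that by (auto simp: int_iterate_def)
    have "False" if x: "x \<in> Pi\<^sub>E {1..n} (\<lambda>_. N \<omega>)" "x \<in> same_orbit n i j k" "x \<in> distinct_tuples n" for x
    proof -
      have xN: "x i \<in> N \<omega>" "x j \<in> N \<omega>" using x(1) ij by auto
      have "inj_on x {1..n}" using x(3) by (simp add: distinct_tuples_def)
      then have ne: "x i \<noteq> x j" using ij(3,1,2) by (rule inj_on_contraD)
      have eq: "x j = int_iterate UNIV T k (x i)" using x(2) by (simp add: same_orbit_def)
      consider "k = 0" | "k > 0" | "k < 0" by linarith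
      then show False
      proof cases
        case 1 then show False using eq ne by (simp add: int_iterate_def)
      next
        case 2 then show False using eq disj[of "nat k" "x i"] xN by (simp add: int_iterate_def)
      next
        case 3
        then have "x j = (inv T ^^ nat (- k)) (x i)" using eq by (simp add: int_iterate_def)
        then have "(T ^^ nat (- k)) (x j) = x i"
          using fn_o_inv_fn_is_id[OF bij_T, of "nat (- k)"] by (simp add: fun_eq_iff)
        then show False using disj[of "nat (- k)" "x j"] xN 3 by simp
      qed
    qed
    then show ?case unfolding tuples_def by (auto simp: emeasure_count_space_eq_0)
  qed
  then show ?thesis
    using same_orbit[OF ij(1,2)] by (simp add: emeasure_factorial_moment_measure nn_integral_0_iff_AE)
qed

text \<open>Both sides are integrals over the ergodic components, and the identity already holds for almost every
component: it is a multiple of \<open>\<mu>\<^sup>n\<close>, or it is null because it is carried by an orbit relation that \<open>\<sigma>\<^sub>n\<close>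
does not charge.  Comparing with a fixed cube \<open>Q\<^sup>n\<close> avoids the measurability of the proportionality factor
as a function of the component.\<close>

lemma factorial_moment_rectangle_proportional:
  assumes n: "n \<ge> 1" and A: "\<And>i. i \<in> {1..n} \<Longrightarrow> A i \<in> sets borel" and Q: "Q \<in> sets borel"
  shows "emeasure (factorial_moment_measure n) (Pi\<^sub>E {1..n} A) * emeasure \<mu> Q ^ n =
    emeasure (factorial_moment_measure n) (Pi\<^sub>E {1..n} (\<lambda>_. Q)) * (\<Prod>i\<in>{1..n}. emeasure \<mu> (A i))"
proof -
  let ?\<sigma> = "factorial_moment_measure n"
  obtain \<Lambda> where \<Lambda>: "ergodic_decomposition ?\<sigma> (product_map n T) \<Lambda>"
    and comp: "AE \<rho> in \<Lambda>. \<exists>\<pi> \<kappa> m. \<exists>c::real. partition_on {1..n} \<pi> \<and> pi_compatible \<pi> \<kappa> \<and>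
        is_m_measure \<mu> T n \<pi> \<kappa> m \<and> 0 < c \<and> \<rho> = scale_measure (ennreal c) m"
    using P2 n factorial_moment_measure_invariant[of n] factorial_moment_measure_boundedly_finite[of n]
      factorial_moment_measure_marginal[of _ n] sets_factorial_moment_measure[of n]
    unfolding property_P2_def by blast
  have meas: "(\<lambda>\<rho>. emeasure \<rho> B) \<in> borel_measurable \<Lambda>"
    and disint: "emeasure ?\<sigma> B = (\<integral>\<^sup>+\<rho>. emeasure \<rho> B \<partial>\<Lambda>)" if "B \<in> sets (product_space n)" for B
    using \<Lambda> that by (auto simp: ergodic_decomposition_def)
  have off: "AE \<rho> in \<Lambda>. \<forall>i j k. i \<in> {1..n} \<longrightarrow> j \<in> {1..n} \<longrightarrow> i \<noteq> j \<longrightarrow> emeasure \<rho> (same_orbit n i j k) = 0"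
    unfolding AE_all_countable
  proof (intro allI)
    fix i j :: nat and k :: int
    show "AE \<rho> in \<Lambda>. i \<in> {1..n} \<longrightarrow> j \<in> {1..n} \<longrightarrow> i \<noteq> j \<longrightarrow> emeasure \<rho> (same_orbit n i j k) = 0"
    proof (cases "i \<in> {1..n} \<and> j \<in> {1..n} \<and> i \<noteq> j")
      case True
      then have "(\<integral>\<^sup>+\<rho>. emeasure \<rho> (same_orbit n i j k) \<partial>\<Lambda>) = 0"
        using disint[OF same_orbit, of i j k] factorial_moment_measure_same_orbit[of i n j k] by simp
      then have "AE \<rho> in \<Lambda>. emeasure \<rho> (same_orbit n i j k) = 0"
        using True meas[OF same_orbit, of i j k] by (simp add: nn_integral_0_iff_AE)
      then show ?thesis by eventually_elim simp
    qed auto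
  qed
  have RA: "Pi\<^sub>E {1..n} A \<in> sets (product_space n)" and RQ: "Pi\<^sub>E {1..n} (\<lambda>_. Q) \<in> sets (product_space n)"
    using A Q by (auto intro!: sets_PiM_I_finite)
  have proportional: "AE \<rho> in \<Lambda>. emeasure \<rho> (Pi\<^sub>E {1..n} A) * emeasure \<mu> Q ^ n =
      emeasure \<rho> (Pi\<^sub>E {1..n} (\<lambda>_. Q)) * (\<Prod>i\<in>{1..n}. emeasure \<mu> (A i))"
    using comp off
  proof eventually_elim
    case (elim \<rho>)
    from elim(1) obtain \<pi> \<kappa> m and c :: real where \<pi>: "partition_on {1..n} \<pi>" "pi_compatible \<pi> \<kappa>"
      and m: "is_m_measure \<mu> T n \<pi> \<kappa> m" and \<rho>: "\<rho> = scale_measure (ennreal c) m" by blast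
    have sm: "sets m = sets (product_space n)" using m by (simp add: is_m_measure_def)
    show ?case
    proof (cases "\<forall>P\<in>\<pi>. \<forall>i\<in>P. \<forall>j\<in>P. i = j")
      case True
      then have s: "\<pi> = (\<lambda>i. {i}) ` {1..n}" using \<pi>(1) by (intro partition_all_singletons) auto
      have "emeasure m (Pi\<^sub>E {1..n} A) = (\<Prod>i\<in>{1..n}. emeasure \<mu> (A i))"
        using A by (intro m_measure_singletons[OF m s \<pi>(2)])
      moreover have "emeasure m (Pi\<^sub>E {1..n} (\<lambda>_. Q)) = emeasure \<mu> Q ^ n"
        using Q m_measure_singletons[OF m s \<pi>(2), of "\<lambda>_. Q"] by simp
      ultimately show ?thesis by (simp add: \<rho> mult_ac)
    next
      case False
      then obtain P i j where P: "P \<in> \<pi>" "i \<in> P" "j \<in> P" "i \<noteq> j" by blast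
      have Psub: "P \<subseteq> {1..n}" using \<pi>(1) P by (auto simp: partition_on_def)
      then have min: "Min P \<in> P" using P by (auto intro!: Min_in intro: finite_subset)
      obtain j' where j': "j' \<in> P" "j' \<noteq> Min P" using P by metis
      let ?Z = "same_orbit n (Min P) j' (\<kappa> j')"
      have Z: "?Z \<in> sets (product_space n)" using min j' Psub by (intro same_orbit) auto
      have "emeasure \<rho> ?Z = 0" using elim(2) min j' Psub by blast
      moreover have "emeasure \<rho> (space (product_space n) - ?Z) = 0"
        unfolding \<rho> using m_measure_concentrated[OF m \<pi> P(1) j'(1)] by simp
      ultimately have nullZ: "?Z \<union> (space (product_space n) - ?Z) \<in> null_sets \<rho>"
        using Z sm by (intro null_sets.Un) (auto simp: null_sets_def \<rho>)
      have null: "emeasure \<rho> B = 0" if "B \<in> sets (product_space n)" for B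
      proof (rule emeasure_eq_0[OF null_setsD2[OF nullZ] null_setsD1[OF nullZ]])
        show "B \<subseteq> ?Z \<union> (space (product_space n) - ?Z)" using sets.sets_into_space[OF that] by blast
      qed
      show ?thesis by (simp add: null RA RQ)
    qed
  qed
  have "emeasure ?\<sigma> (Pi\<^sub>E {1..n} A) * emeasure \<mu> Q ^ n =
      (\<integral>\<^sup>+\<rho>. emeasure \<rho> (Pi\<^sub>E {1..n} A) * emeasure \<mu> Q ^ n \<partial>\<Lambda>)"
    using meas[OF RA] by (simp add: disint[OF RA] nn_integral_multc)
  also have "\<dots> = (\<integral>\<^sup>+\<rho>. emeasure \<rho> (Pi\<^sub>E {1..n} (\<lambda>_. Q)) * (\<Prod>i\<in>{1..n}. emeasure \<mu> (A i)) \<partial>\<Lambda>)"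
    by (rule nn_integral_cong_AE[OF proportional])
  also have "\<dots> = emeasure ?\<sigma> (Pi\<^sub>E {1..n} (\<lambda>_. Q)) * (\<Prod>i\<in>{1..n}. emeasure \<mu> (A i))"
    using meas[OF RQ] by (simp add: disint[OF RQ] nn_integral_multc)
  finally show ?thesis .
qed

end

section \<open>First and second moments\<close>

context invariant_point_process
begin

lemma exists_window_positive: "\<exists>m. 0 < emeasure \<mu> (window m)"
proof (rule ccontr)
  assume "\<not> ?thesis"
  then have "emeasure \<mu> (\<Union>m. window m) = 0" by (intro emeasure_UN_eq_0) auto
  then show False using system Union_window by (simp add: infinite_cons_ergodic_system_def)
qed

text \<open>Any bounded set of positive measure would do; it normalizes the constants \<open>c\<^sub>n\<close>.\<close>

definition reference_set :: "'a set" where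
  "reference_set = window (SOME m. 0 < emeasure \<mu> (window m))"

lemma reference_set [measurable]: "reference_set \<in> sets borel"
  and bounded_reference_set: "bounded reference_set"
  and reference_set_finite: "emeasure \<mu> reference_set < \<infinity>"
  and reference_set_pos: "0 < measure \<mu> reference_set"
proof -
  show f: "emeasure \<mu> reference_set < \<infinity>" by (simp only: reference_set_def window_finite)
  have "0 < emeasure \<mu> reference_set" unfolding reference_set_def by (rule someI_ex[OF exists_window_positive])
  then show "0 < measure \<mu> reference_set"
    using f by (simp add: measure_def enn2real_positive_iff)
qed (auto simp: reference_set_def bounded_window)

definition points :: "'a set \<Rightarrow> 'w \<Rightarrow> nat" where
  "points A \<omega> = card (N \<omega> \<inter> A)"

lemma measurable_points [measurable]:
  assumes [measurable]: "A \<in> sets borel"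
  shows "points A \<in> measurable M (count_space UNIV)"
proof -
  have "enn2real (num_points (N \<omega>) A) = real (points A \<omega>)" for \<omega>
    by (auto simp: num_points_def points_def emeasure_count_space)
  then have "points A = (\<lambda>\<omega>. nat \<lfloor>enn2real (num_points (N \<omega>) A)\<rfloor>)" by (auto simp: fun_eq_iff)
  also have "\<dots> \<in> measurable M (count_space UNIV)" by measurable
  finally show ?thesis .
qed

lemma AE_num_points_eq:
  assumes "A \<in> sets borel" "emeasure \<mu> A < \<infinity>"
  shows "AE \<omega> in M. num_points (N \<omega>) A = of_nat (points A \<omega>)"
  using AE_finite_points[OF assms] by eventually_elim (simp add: num_points_def points_def)

lemma measure_vimage_T:
  assumes "A \<in> sets borel"
  shows "T -` A \<in> sets borel" "emeasure \<mu> (T -` A) = emeasure \<mu> A"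
proof -
  show "T -` A \<in> sets borel" using measurable_sets[OF measurable_T assms] by simp
  have "emeasure \<mu> A = emeasure (distr \<mu> \<mu> T) A" by (simp only: distr_T)
  also have "\<dots> = emeasure \<mu> (T -` A)"
    using assms by (subst emeasure_distr) (simp_all cong: measurable_cong_sets)
  finally show "emeasure \<mu> (T -` A) = emeasure \<mu> A" ..
qed

lemma AE_points_shift: "AE \<omega> in M. \<forall>A. points A (S \<omega>) = points (T -` A) \<omega>"
  using AE_N_equivariant
proof eventually_elim
  case (elim \<omega>)
  have "points A (S \<omega>) = card (T ` (N \<omega> \<inter> T -` A))" for A
    unfolding points_def elim by (rule arg_cong[of _ _ card]) auto
  then show ?case
    using bij_is_inj[OF bij_T] by (simp add: points_def card_image inj_on_subset)
qed

text \<open>The factor \<open>c\<^sub>n\<close> between the factorial moment measure and \<open>\<mu>\<^sup>n\<close> on rectangles, read off from one cube.\<close>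

definition moment_constant :: "nat \<Rightarrow> real" where
  "moment_constant n = enn2real (emeasure (factorial_moment_measure n) (Pi\<^sub>E {1..n} (\<lambda>_. reference_set)))
     / measure \<mu> reference_set ^ n"

lemma moment_constant_nonneg: "0 \<le> moment_constant n"
  unfolding moment_constant_def by simp

end

context free_point_process
begin

lemma factorial_moment_rectangle:
  assumes A: "\<And>i. i \<in> {1..n} \<Longrightarrow> A i \<in> sets borel"
  shows "emeasure (factorial_moment_measure n) (Pi\<^sub>E {1..n} A) =
    ennreal (moment_constant n) * (\<Prod>i\<in>{1..n}. emeasure \<mu> (A i))"
proof -
  let ?\<sigma> = "factorial_moment_measure n" and ?Q = "reference_set"
  let ?q = "measure \<mu> ?Q ^ n" and ?s = "enn2real (emeasure ?\<sigma> (Pi\<^sub>E {1..n} (\<lambda>_. ?Q)))"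
  have q: "0 < ?q" using reference_set_pos by simp
  have "emeasure \<mu> ?Q = ennreal (measure \<mu> ?Q)"
    using reference_set_finite by (intro emeasure_eq_ennreal_measure) auto
  then have eq: "emeasure \<mu> ?Q ^ n = ennreal ?q" by (simp add: ennreal_power)
  have "bounded ((\<lambda>x. x i) ` Pi\<^sub>E {1..n} (\<lambda>_. ?Q))" if "i \<in> {1..n}" for i
    by (rule bounded_subset[OF bounded_reference_set]) (use that in auto)
  then have "emeasure ?\<sigma> (Pi\<^sub>E {1..n} (\<lambda>_. ?Q)) < \<infinity>"
    using factorial_moment_measure_boundedly_finite[of n]
    by (auto simp: boundedly_finite_prod_def intro!: sets_PiM_I_finite)
  then have s: "emeasure ?\<sigma> (Pi\<^sub>E {1..n} (\<lambda>_. ?Q)) = ennreal ?s" by simp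
  have "emeasure ?\<sigma> (Pi\<^sub>E {1..n} A) * ennreal ?q = ennreal ?s * (\<Prod>i\<in>{1..n}. emeasure \<mu> (A i))"
  proof (cases "n = 0")
    case True
    then show ?thesis using s by simp
  next
    case False
    then show ?thesis
      using factorial_moment_rectangle_proportional[OF _ A reference_set, of n] s eq by simp
  qed
  then have "emeasure ?\<sigma> (Pi\<^sub>E {1..n} A) * ennreal ?q * ennreal (1 / ?q) =
      ennreal (1 / ?q) * ennreal ?s * (\<Prod>i\<in>{1..n}. emeasure \<mu> (A i))" by (simp add: mult_ac)
  moreover have "ennreal ?q * ennreal (1 / ?q) = 1"
    using q reference_set_pos by (subst ennreal_mult[symmetric]) auto
  moreover have "ennreal (1 / ?q) * ennreal ?s = ennreal (moment_constant n)"
    using q reference_set_pos by (subst ennreal_mult[symmetric]) (auto simp: moment_constant_def)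
  ultimately show ?thesis by (simp add: mult.assoc)
qed

text \<open>A product of falling factorials of the counts of disjoint sets is the number of injective tuples of \<open>N\<close> in
a rectangle whose sides repeat each \<open>B i\<close> exactly \<open>e i\<close> times.\<close>

lemma factorial_moments:
  fixes B :: "'i \<Rightarrow> 'a set"
  assumes I: "finite I" and B: "\<And>i. i \<in> I \<Longrightarrow> B i \<in> sets borel"
    and fin: "\<And>i. i \<in> I \<Longrightarrow> emeasure \<mu> (B i) < \<infinity>" and disj: "disjoint_family_on B I"
  shows "has_bochner_integral M (\<lambda>\<omega>. \<Prod>i\<in>I. real (fact (e i) * (points (B i) \<omega> choose e i)))
    (moment_constant (sum e I) * (\<Prod>i\<in>I. measure \<mu> (B i) ^ e i))"
proof -
  let ?n = "sum e I"
  obtain g :: "nat \<Rightarrow> 'i" where g: "g ` {1..?n} \<subseteq> I" and ge: "\<And>i. i \<in> I \<Longrightarrow> card {l\<in>{1..?n}. g l = i} = e i"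
    using exists_map_with_fibers[OF I, of e] by blast
  let ?R = "Pi\<^sub>E {1..?n} (\<lambda>l. B (g l))"
  have gB: "B (g l) \<in> sets borel" if "l \<in> {1..?n}" for l using g that B by blast
  have R: "?R \<in> sets (product_space ?n)" using gB by (auto intro!: sets_PiM_I_finite)
  have "AE \<omega> in M. \<forall>i\<in>I. finite (N \<omega> \<inter> B i)"
    using AE_finite_points[OF B fin] I by (simp add: AE_finite_all)
  then have AEt: "AE \<omega> in M. tuples ?n \<omega> (?R \<inter> distinct_tuples ?n) =
      ennreal (\<Prod>i\<in>I. real (fact (e i) * (points (B i) \<omega> choose e i)))"
  proof eventually_elim
    case (elim \<omega>)
    have sub: "Pi\<^sub>E {1..?n} (\<lambda>_. N \<omega>) \<subseteq> space (product_space ?n)"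
      unfolding space_PiM by (rule PiE_mono) simp
    have set_eq: "Pi\<^sub>E {1..?n} (\<lambda>_. N \<omega>) \<inter> (?R \<inter> distinct_tuples ?n) =
        {x \<in> Pi\<^sub>E {1..?n} (\<lambda>l. N \<omega> \<inter> B (g l)). inj_on x {1..?n}}"
      unfolding PiE_Int[symmetric] distinct_tuples_def using sub by blast
    have "finite (Pi\<^sub>E {1..?n} (\<lambda>l. N \<omega> \<inter> B (g l)))" using elim g by (intro finite_PiE) blast+
    then have "finite {x \<in> Pi\<^sub>E {1..?n} (\<lambda>l. N \<omega> \<inter> B (g l)). inj_on x {1..?n}}" by auto
    then have "tuples ?n \<omega> (?R \<inter> distinct_tuples ?n) =
        of_nat (card {x \<in> Pi\<^sub>E {1..?n} (\<lambda>l. N \<omega> \<inter> B (g l)). inj_on x {1..?n}})"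
      unfolding tuples_def set_eq by simp
    also have "card {x \<in> Pi\<^sub>E {1..?n} (\<lambda>l. N \<omega> \<inter> B (g l)). inj_on x {1..?n}} =
        (\<Prod>i\<in>I. fact (e i) * (points (B i) \<omega> choose e i))"
      using card_injective_tuples[of "{1..?n}" I g "\<lambda>i. N \<omega> \<inter> B i"] I g elim disj ge
      by (simp add: points_def disjoint_family_on_def) blast
    finally show ?case by (simp add: ennreal_of_nat_eq_real_of_nat)
  qed
  have "(\<integral>\<^sup>+\<omega>. ennreal (\<Prod>i\<in>I. real (fact (e i) * (points (B i) \<omega> choose e i))) \<partial>M) =
      emeasure (factorial_moment_measure ?n) ?R"
    unfolding emeasure_factorial_moment_measure[OF R] using AEt by (intro nn_integral_cong_AE) auto
  also have "\<dots> = ennreal (moment_constant ?n) * (\<Prod>l\<in>{1..?n}. emeasure \<mu> (B (g l)))"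
    by (rule factorial_moment_rectangle[OF gB])
  also have "(\<Prod>l\<in>{1..?n}. emeasure \<mu> (B (g l))) = (\<Prod>i\<in>I. \<Prod>l\<in>{l\<in>{1..?n}. g l = i}. emeasure \<mu> (B (g l)))"
    using I g by (intro prod.group[symmetric]) auto
  also have "\<dots> = (\<Prod>i\<in>I. ennreal (measure \<mu> (B i) ^ e i))"
  proof (rule prod.cong[OF refl])
    fix i assume i: "i \<in> I"
    have "(\<Prod>l\<in>{l\<in>{1..?n}. g l = i}. emeasure \<mu> (B (g l))) = emeasure \<mu> (B i) ^ e i"
      using ge[OF i] by simp
    also have "emeasure \<mu> (B i) = ennreal (measure \<mu> (B i))"
      using fin[OF i] by (intro emeasure_eq_ennreal_measure) auto
    finally show "(\<Prod>l\<in>{l\<in>{1..?n}. g l = i}. emeasure \<mu> (B (g l))) = ennreal (measure \<mu> (B i) ^ e i)"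
      by (simp add: ennreal_power)
  qed
  also have "ennreal (moment_constant ?n) * \<dots> =
      ennreal (moment_constant ?n * (\<Prod>i\<in>I. measure \<mu> (B i) ^ e i))"
    by (simp add: prod_ennreal ennreal_mult moment_constant_nonneg prod_nonneg)
  finally have nn: "(\<integral>\<^sup>+\<omega>. ennreal (\<Prod>i\<in>I. real (fact (e i) * (points (B i) \<omega> choose e i))) \<partial>M) =
      ennreal (moment_constant ?n * (\<Prod>i\<in>I. measure \<mu> (B i) ^ e i))" .
  have meas: "(\<lambda>\<omega>. \<Prod>i\<in>I. real (fact (e i) * (points (B i) \<omega> choose e i))) \<in> borel_measurable M"
  proof (rule borel_measurable_prod)
    fix i assume "i \<in> I"
    then have [measurable]: "points (B i) \<in> measurable M (count_space UNIV)" by (intro measurable_points B)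
    show "(\<lambda>\<omega>. real (fact (e i) * (points (B i) \<omega> choose e i))) \<in> borel_measurable M" by measurable
  qed
  show ?thesis
    by (rule has_bochner_integral_nn_integral[OF meas _ _ nn])
       (auto intro!: mult_nonneg_nonneg prod_nonneg moment_constant_nonneg)
qed

lemma moment_constant_0: "moment_constant 0 = 1"
proof -
  have "has_bochner_integral M (\<lambda>_. 1::real) (moment_constant 0)"
    using factorial_moments[of "{}::nat set" "\<lambda>_. {}" "\<lambda>_. 0"] by (simp add: disjoint_family_on_def)
  moreover have "has_bochner_integral M (\<lambda>_. 1::real) 1"
    using prob_space by (simp add: has_bochner_integral_iff)
  ultimately show ?thesis by (rule has_bochner_integral_eq)
qed

abbreviation "\<alpha> \<equiv> moment_constant 1"

lemma first_moment:
  assumes "B \<in> sets borel" "emeasure \<mu> B < \<infinity>"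
  shows "has_bochner_integral M (\<lambda>\<omega>. real (points B \<omega>)) (\<alpha> * measure \<mu> B)"
  using factorial_moments[of "{()}" "\<lambda>_. B" "\<lambda>_. 1"] assms by (simp add: disjoint_family_on_def One_nat_def)

lemma second_factorial_moment:
  assumes "B \<in> sets borel" "emeasure \<mu> B < \<infinity>"
  shows "has_bochner_integral M (\<lambda>\<omega>. real (points B \<omega>) * (real (points B \<omega>) - 1)) (moment_constant 2 * (measure \<mu> B)\<^sup>2)"
proof -
  have r: "real (fact 2 * (x choose 2)) = real x * (real x - 1)" for x :: nat
  proof -
    have "fact (Suc 1) * (x choose Suc 1) = (x - 1) * (fact 1 * (x choose 1))" by (rule falling_factorial_Suc)
    then have "fact 2 * (x choose 2) = (x - 1) * x" by (simp add: numeral_2_eq_2 One_nat_def)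
    then have "real (fact 2 * (x choose 2)) = real ((x - 1) * x)" by (rule arg_cong)
    then show ?thesis by (cases x) (auto simp: algebra_simps)
  qed
  show ?thesis
    using factorial_moments[of "{()}" "\<lambda>_. B" "\<lambda>_. 2", unfolded r] assms
    by (simp add: disjoint_family_on_def)
qed

lemma second_moment_disjoint:
  assumes "A \<in> sets borel" "emeasure \<mu> A < \<infinity>" "B \<in> sets borel" "emeasure \<mu> B < \<infinity>" "A \<inter> B = {}"
  shows "has_bochner_integral M (\<lambda>\<omega>. real (points A \<omega>) * real (points B \<omega>))
    (moment_constant 2 * (measure \<mu> A * measure \<mu> B))"
  using factorial_moments[of "{True, False}" "\<lambda>b. if b then A else B" "\<lambda>_. 1"] assms
  by (simp add: disjoint_family_on_def numeral_2_eq_2 One_nat_def Int_commute)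

text \<open>In general the mean square contains the further term \<open>c\<^sub>2 (a \<mu>(A) - b \<mu>(B))\<^sup>2\<close>; balanced weights remove it and
leave an expression that is linear in the measures.\<close>

lemma second_moment_difference:
  assumes A: "A \<in> sets borel" "emeasure \<mu> A < \<infinity>" and B: "B \<in> sets borel" "emeasure \<mu> B < \<infinity>"
    and "A \<inter> B = {}" and eq: "a * measure \<mu> A = b * measure \<mu> B"
  shows "has_bochner_integral M (\<lambda>\<omega>. (a * real (points A \<omega>) - b * real (points B \<omega>))\<^sup>2)
    (\<alpha> * (a\<^sup>2 * measure \<mu> A + b\<^sup>2 * measure \<mu> B))"
proof -
  let ?X = "\<lambda>\<omega>. real (points A \<omega>)" and ?Y = "\<lambda>\<omega>. real (points B \<omega>)"
  have "has_bochner_integral M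
     (\<lambda>\<omega>. a\<^sup>2 * (?X \<omega> * (?X \<omega> - 1)) + a\<^sup>2 * ?X \<omega> + b\<^sup>2 * (?Y \<omega> * (?Y \<omega> - 1)) + b\<^sup>2 * ?Y \<omega> - 2 * a * b * (?X \<omega> * ?Y \<omega>))
     (a\<^sup>2 * (moment_constant 2 * (measure \<mu> A)\<^sup>2) + a\<^sup>2 * (\<alpha> * measure \<mu> A) +
      b\<^sup>2 * (moment_constant 2 * (measure \<mu> B)\<^sup>2) + b\<^sup>2 * (\<alpha> * measure \<mu> B) -
      2 * a * b * (moment_constant 2 * (measure \<mu> A * measure \<mu> B)))"
    by (intro has_bochner_integral_add has_bochner_integral_diff has_bochner_integral_mult_right
        first_moment second_factorial_moment second_moment_disjoint assms)
  also have "(\<lambda>\<omega>. a\<^sup>2 * (?X \<omega> * (?X \<omega> - 1)) + a\<^sup>2 * ?X \<omega> + b\<^sup>2 * (?Y \<omega> * (?Y \<omega> - 1)) + b\<^sup>2 * ?Y \<omega> - 2 * a * b * (?X \<omega> * ?Y \<omega>))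
      = (\<lambda>\<omega>. (a * ?X \<omega> - b * ?Y \<omega>)\<^sup>2)"
    by (simp add: fun_eq_iff power2_eq_square algebra_simps)
  also have "a\<^sup>2 * (moment_constant 2 * (measure \<mu> A)\<^sup>2) + a\<^sup>2 * (\<alpha> * measure \<mu> A) +
      b\<^sup>2 * (moment_constant 2 * (measure \<mu> B)\<^sup>2) + b\<^sup>2 * (\<alpha> * measure \<mu> B) -
      2 * a * b * (moment_constant 2 * (measure \<mu> A * measure \<mu> B)) =
      moment_constant 2 * (a * measure \<mu> A - b * measure \<mu> B)\<^sup>2 + \<alpha> * (a\<^sup>2 * measure \<mu> A + b\<^sup>2 * measure \<mu> B)"
    by (simp add: power2_eq_square algebra_simps)
  finally show ?thesis by (simp add: eq)
qed

end

section \<open>A law of large numbers\<close>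

context invariant_point_process
begin

text \<open>The growth \<open>16 ^ j\<close> makes the mean squares in the law of large numbers summable even with the weights \<open>4 ^ j\<close>.\<close>

lemma exists_growing_sets:
  assumes Q: "Q \<in> sets borel" "emeasure \<mu> Q < \<infinity>"
  shows "\<exists>B::nat \<Rightarrow> 'a set. incseq B \<and>
    (\<forall>j. B j \<in> sets borel \<and> emeasure \<mu> (B j) < \<infinity> \<and> 16 ^ j \<le> measure \<mu> (B j) \<and> B j \<inter> Q = {})"
proof -
  let ?W = "\<lambda>m. window m - Q"
  have W [measurable]: "?W m \<in> sets borel" for m using Q by auto
  have Wfin: "emeasure \<mu> (?W m) < \<infinity>" for m
    by (rule le_less_trans[OF emeasure_mono window_finite]) auto
  have Wmono: "?W m \<subseteq> ?W m'" if "m \<le> m'" for m m' using window_mono[OF that] by auto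
  have "(SUP m. emeasure \<mu> (?W m)) = emeasure \<mu> (\<Union>m. ?W m)"
    using Wmono by (intro SUP_emeasure_incseq) (auto simp: incseq_def)
  also have "(\<Union>m. ?W m) = UNIV - Q" using Union_window by auto
  also have "emeasure \<mu> (UNIV - Q) = emeasure \<mu> UNIV - emeasure \<mu> Q"
    using Q by (intro emeasure_Diff) auto
  also have "\<dots> = \<infinity>"
    using system Q by (simp add: infinite_cons_ergodic_system_def)
  finally have "(SUP m. emeasure \<mu> (?W m)) = \<infinity>" .
  then have large: "\<exists>m. 16 ^ j \<le> measure \<mu> (?W m)" for j :: nat
  proof -
    have "ennreal (16 ^ j) < (SUP m. emeasure \<mu> (?W m))"
      unfolding \<open>(SUP m. emeasure \<mu> (?W m)) = \<infinity>\<close> by simp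
    then obtain m where "ennreal (16 ^ j) < emeasure \<mu> (?W m)" unfolding less_SUP_iff by blast
    also have "emeasure \<mu> (?W m) = ennreal (measure \<mu> (?W m))"
      using Wfin[of m] by (intro emeasure_eq_ennreal_measure) auto
    finally have "16 ^ j < measure \<mu> (?W m)" by (simp add: ennreal_less_iff)
    then show ?thesis by (intro exI[of _ m]) simp
  qed
  define k where "k j = (LEAST m. 16 ^ j \<le> measure \<mu> (?W m))" for j :: nat
  have k: "16 ^ j \<le> measure \<mu> (?W (k j))" for j unfolding k_def by (rule LeastI_ex[OF large])
  have kmono: "k i \<le> k j" if "i \<le> j" for i j
  proof -
    have "(16::real) ^ i \<le> 16 ^ j" using that by (intro power_increasing) auto
    then have "16 ^ i \<le> measure \<mu> (?W (k j))" using k[of j] by linarith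
    then show ?thesis unfolding k_def[of i] by (rule Least_le)
  qed
  show ?thesis
  proof (intro exI[of _ "\<lambda>j. ?W (k j)"] conjI allI)
    show "incseq (\<lambda>j. ?W (k j))" unfolding incseq_def using kmono Wmono by blast
  qed (use W Wfin k in auto)
qed

lemma AE_points_Diff:
  assumes "A \<subseteq> B" "B \<in> sets borel" "emeasure \<mu> B < \<infinity>"
  shows "AE \<omega> in M. real (points B \<omega>) = real (points A \<omega>) + real (points (B - A) \<omega>)"
  using AE_finite_points[OF assms(2,3)]
proof eventually_elim
  case (elim \<omega>)
  have "N \<omega> \<inter> B = (N \<omega> \<inter> A) \<union> (N \<omega> \<inter> (B - A))" using assms(1) by auto
  moreover have "finite (N \<omega> \<inter> A)" "finite (N \<omega> \<inter> (B - A))"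
    by (rule finite_subset[OF _ elim]; use assms(1) in auto)+
  moreover have "(N \<omega> \<inter> A) \<inter> (N \<omega> \<inter> (B - A)) = {}" by auto
  ultimately have "points B \<omega> = points A \<omega> + points (B - A) \<omega>"
    unfolding points_def by (metis card_Un_disjoint)
  then show ?case by simp
qed

lemma measure_Diff_eq:
  assumes "A \<subseteq> B" "A \<in> sets borel" "B \<in> sets borel" "emeasure \<mu> B < \<infinity>"
  shows "emeasure \<mu> A < \<infinity>" "emeasure \<mu> (B - A) < \<infinity>" "measure \<mu> (B - A) = measure \<mu> B - measure \<mu> A"
proof -
  show "emeasure \<mu> A < \<infinity>" "emeasure \<mu> (B - A) < \<infinity>"
    by (rule le_less_trans[OF emeasure_mono assms(4)]; use assms in auto)+
  show "measure \<mu> (B - A) = measure \<mu> B - measure \<mu> A"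
    using assms by (intro measure_Diff) auto
qed

end

context free_point_process
begin

text \<open>Write \<open>B\<close> as the union of \<open>A\<close> and \<open>B - A\<close>; the resulting weights are balanced.\<close>

lemma second_moment_nested:
  assumes AB: "A \<subseteq> B" and A: "A \<in> sets borel" and B: "B \<in> sets borel" "emeasure \<mu> B < \<infinity>"
    and pos: "0 < measure \<mu> A"
  shows "has_bochner_integral M (\<lambda>\<omega>. (real (points A \<omega>) / measure \<mu> A - real (points B \<omega>) / measure \<mu> B)\<^sup>2)
    (\<alpha> * (1 / measure \<mu> A - 1 / measure \<mu> B))"
proof -
  let ?a = "measure \<mu> A" and ?b = "measure \<mu> B"
  note D = measure_Diff_eq[OF AB A B]
  have b: "0 < ?b" using pos D(3) measure_nonneg[of \<mu> "B - A"] by linarith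
  have "(1 / ?a - 1 / ?b) * ?a = (1 / ?b) * measure \<mu> (B - A)"
    unfolding D(3) using pos b by (simp add: field_simps)
  then have hbi: "has_bochner_integral M (\<lambda>\<omega>. ((1 / ?a - 1 / ?b) * real (points A \<omega>) - (1 / ?b) * real (points (B - A) \<omega>))\<^sup>2)
    (\<alpha> * ((1 / ?a - 1 / ?b)\<^sup>2 * ?a + (1 / ?b)\<^sup>2 * measure \<mu> (B - A)))"
    using A B D by (intro second_moment_difference) auto
  have val: "(1 / ?a - 1 / ?b)\<^sup>2 * ?a + (1 / ?b)\<^sup>2 * measure \<mu> (B - A) = 1 / ?a - 1 / ?b"
    unfolding D(3) using pos b by (simp add: field_simps power2_eq_square)
  have ae: "AE \<omega> in M. ((1 / ?a - 1 / ?b) * real (points A \<omega>) - (1 / ?b) * real (points (B - A) \<omega>))\<^sup>2 =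
      (real (points A \<omega>) / ?a - real (points B \<omega>) / ?b)\<^sup>2"
    using AE_points_Diff[OF AB B]
  proof eventually_elim
    case (elim \<omega>)
    show ?case unfolding elim by (simp add: algebra_simps add_divide_distrib)
  qed
  have [measurable]: "points A \<in> measurable M (count_space UNIV)"
    "points B \<in> measurable M (count_space UNIV)" "points (B - A) \<in> measurable M (count_space UNIV)"
    using A B by (auto intro!: measurable_points)
  show ?thesis
    by (rule has_bochner_integral_cong_AE[THEN iffD1, OF _ _ ae hbi[unfolded val]]) measurable
qed

text \<open>By equivariance \<open>points B (S \<omega>)\<close> is the count of \<open>T\<^sup>-\<^sup>1B\<close>.  The common part of \<open>B\<close> and \<open>T\<^sup>-\<^sup>1B\<close> cancels, and
what remains are two disjoint sets of equal measure.\<close>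

lemma second_moment_shift:
  assumes B: "B \<in> sets borel" "emeasure \<mu> B < \<infinity>" and pos: "0 < measure \<mu> B"
  shows "integrable M (\<lambda>\<omega>. (real (points B (S \<omega>)) / measure \<mu> B - real (points B \<omega>) / measure \<mu> B)\<^sup>2)"
    and "(\<integral>\<omega>. (real (points B (S \<omega>)) / measure \<mu> B - real (points B \<omega>) / measure \<mu> B)\<^sup>2 \<partial>M) \<le> 2 * \<alpha> / measure \<mu> B"
proof -
  let ?b = "measure \<mu> B" and ?B' = "T -` B"
  have B': "?B' \<in> sets borel" "emeasure \<mu> ?B' < \<infinity>" using measure_vimage_T[OF B(1)] B(2) by auto
  have b': "measure \<mu> ?B' = ?b" using measure_vimage_T[OF B(1)] by (simp add: measure_def)
  have I: "B \<inter> ?B' \<in> sets borel" using B B' by auto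
  note D = measure_Diff_eq[OF _ I B] and D' = measure_Diff_eq[OF _ I B']
  have eqm: "measure \<mu> (?B' - B \<inter> ?B') = measure \<mu> (B - B \<inter> ?B')" using D(3) D'(3) b' by auto
  let ?p = "measure \<mu> (B - B \<inter> ?B')"
  have hbi: "has_bochner_integral M
      (\<lambda>\<omega>. ((1 / ?b) * real (points (?B' - B \<inter> ?B') \<omega>) - (1 / ?b) * real (points (B - B \<inter> ?B') \<omega>))\<^sup>2)
      (\<alpha> * ((1 / ?b)\<^sup>2 * ?p + (1 / ?b)\<^sup>2 * ?p))"
    using second_moment_difference[of "?B' - B \<inter> ?B'" "B - B \<inter> ?B'" "1 / ?b" "1 / ?b"] B B' I D(2) D'(2) eqm
    by auto
  have AE_eq: "AE \<omega> in M. ((1 / ?b) * real (points (?B' - B \<inter> ?B') \<omega>) - (1 / ?b) * real (points (B - B \<inter> ?B') \<omega>))\<^sup>2 =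
      (real (points B (S \<omega>)) / ?b - real (points B \<omega>) / ?b)\<^sup>2"
    using AE_points_Diff[OF _ B, of "B \<inter> ?B'", OF Int_lower1] AE_points_Diff[OF _ B', of "B \<inter> ?B'", OF Int_lower2] AE_points_shift
  proof eventually_elim
    case (elim \<omega>)
    show ?case unfolding elim(3)[rule_format] elim(1,2) by (simp add: algebra_simps add_divide_distrib)
  qed
  have [measurable]: "points B \<in> measurable M (count_space UNIV)" "points (?B' - B \<inter> ?B') \<in> measurable M (count_space UNIV)"
    "points (B - B \<inter> ?B') \<in> measurable M (count_space UNIV)"
    using B B' I by (auto intro!: measurable_points)
  have "has_bochner_integral M (\<lambda>\<omega>. (real (points B (S \<omega>)) / ?b - real (points B \<omega>) / ?b)\<^sup>2)
      (\<alpha> * ((1 / ?b)\<^sup>2 * ?p + (1 / ?b)\<^sup>2 * ?p))"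
    by (rule has_bochner_integral_cong_AE[THEN iffD1, OF _ _ AE_eq hbi]) measurable
  moreover have "\<alpha> * ((1 / ?b)\<^sup>2 * ?p + (1 / ?b)\<^sup>2 * ?p) \<le> 2 * \<alpha> / ?b"
  proof -
    have "?p \<le> ?b" using D(3) measure_nonneg[of \<mu> "B \<inter> ?B'"] by auto
    then have "(1 / ?b)\<^sup>2 * ?p \<le> (1 / ?b)\<^sup>2 * ?b" by (intro mult_left_mono) auto
    also have "\<dots> = 1 / ?b" using pos by (simp add: power2_eq_square)
    finally have "\<alpha> * ((1 / ?b)\<^sup>2 * ?p + (1 / ?b)\<^sup>2 * ?p) \<le> \<alpha> * (1 / ?b + 1 / ?b)"
      by (intro mult_left_mono add_mono moment_constant_nonneg)
    also have "\<dots> = 2 * \<alpha> / ?b" by simp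
    finally show ?thesis .
  qed
  ultimately show "integrable M (\<lambda>\<omega>. (real (points B (S \<omega>)) / ?b - real (points B \<omega>) / ?b)\<^sup>2)"
    "(\<integral>\<omega>. (real (points B (S \<omega>)) / ?b - real (points B \<omega>) / ?b)\<^sup>2 \<partial>M) \<le> 2 * \<alpha> / ?b"
    by (auto simp: has_bochner_integral_iff)
qed

text \<open>The averages are Cauchy in mean square by \<open>second_moment_nested\<close>, so quickly that they converge almost surely to a
limit \<open>V\<close>, and Fatou's lemma carries the mean square bound over to \<open>V\<close>.  By \<open>second_moment_shift\<close> the limit is
invariant; as \<open>S\<close> is ergodic, the event \<open>V > \<alpha>\<close> has probability zero or one, and since \<open>V\<close> has mean \<open>\<alpha>\<close> this
forces \<open>V = \<alpha>\<close>.\<close>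

lemma law_of_large_numbers:
  fixes B :: "nat \<Rightarrow> 'a set"
  assumes inc: "incseq B" and B: "\<And>j. B j \<in> sets borel" "\<And>j. emeasure \<mu> (B j) < \<infinity>"
    and large: "\<And>j. 16 ^ j \<le> measure \<mu> (B j)"
  shows "integrable M (\<lambda>\<omega>. (real (points (B j) \<omega>) / measure \<mu> (B j) - \<alpha>)\<^sup>2)"
    and "(\<integral>\<omega>. (real (points (B j) \<omega>) / measure \<mu> (B j) - \<alpha>)\<^sup>2 \<partial>M) \<le> \<alpha> / 16 ^ j"
proof -
  define f where "f j \<omega> = real (points (B j) \<omega>) / measure \<mu> (B j)" for j \<omega>
  have \<alpha>0: "0 \<le> \<alpha>" by (rule moment_constant_nonneg)
  have pos: "0 < measure \<mu> (B j)" for j using large[of j] by (rule less_le_trans[rotated]) simp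
  have [measurable]: "f j \<in> borel_measurable M" for j
    unfolding f_def using measurable_points[OF B(1)[of j]] by measurable
  have f0: "0 \<le> f j \<omega>" for j \<omega> by (simp add: f_def)
  have mean: "integrable M (f j)" "(\<integral>\<omega>. f j \<omega> \<partial>M) = \<alpha>" for j
    using first_moment[OF B(1,2)[of j]] pos[of j] by (auto simp: f_def[abs_def] has_bochner_integral_iff)
  have inv_le: "\<alpha> / measure \<mu> (B i) \<le> \<alpha> / 16 ^ i" for i
    using large[of i] \<alpha>0 pos[of i] by (intro divide_left_mono) auto
  have diff: "integrable M (\<lambda>\<omega>. (f i \<omega> - f j \<omega>)\<^sup>2)" "(\<integral>\<omega>. (f i \<omega> - f j \<omega>)\<^sup>2 \<partial>M) \<le> \<alpha> / 16 ^ i"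
    if "i \<le> j" for i j
  proof -
    have hbi: "has_bochner_integral M (\<lambda>\<omega>. (f i \<omega> - f j \<omega>)\<^sup>2) (\<alpha> * (1 / measure \<mu> (B i) - 1 / measure \<mu> (B j)))"
      unfolding f_def using B pos incseqD[OF inc that] by (intro second_moment_nested) auto
    then show "integrable M (\<lambda>\<omega>. (f i \<omega> - f j \<omega>)\<^sup>2)" by (simp add: has_bochner_integral_iff)
    have "\<alpha> * (1 / measure \<mu> (B i) - 1 / measure \<mu> (B j)) \<le> \<alpha> * (1 / measure \<mu> (B i))"
      using \<alpha>0 pos[of j] by (intro mult_left_mono) auto
    then show "(\<integral>\<omega>. (f i \<omega> - f j \<omega>)\<^sup>2 \<partial>M) \<le> \<alpha> / 16 ^ i"
      using hbi inv_le[of i] by (simp add: has_bochner_integral_iff)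
  qed
  have quarter: "4 ^ j * (c / 16 ^ j) = c * (1 / 4) ^ j" for c :: real and j :: nat
  proof -
    have "(16::real) ^ j = 4 ^ j * 4 ^ j" by (simp flip: power_mult_distrib)
    then show ?thesis by (simp add: power_divide)
  qed
  have sumq: "summable (\<lambda>j. c * (1 / 4) ^ j)" for c :: real
    by (intro summable_mult summable_geometric) auto

  have "AE \<omega> in M. summable (\<lambda>j. 4 ^ j * (f j \<omega> - f (Suc j) \<omega>)\<^sup>2)"
  proof (rule AE_summable_of_summable_integrals[OF _ _ _ sumq[of \<alpha>]])
    fix j
    show "integrable M (\<lambda>\<omega>. 4 ^ j * (f j \<omega> - f (Suc j) \<omega>)\<^sup>2)" by (intro integrable_mult_right diff) simp
    have "(\<integral>\<omega>. 4 ^ j * (f j \<omega> - f (Suc j) \<omega>)\<^sup>2 \<partial>M) \<le> 4 ^ j * (\<alpha> / 16 ^ j)"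
      unfolding integral_mult_right_zero using diff(2)[of j "Suc j"] by (intro mult_left_mono) auto
    then show "(\<integral>\<omega>. 4 ^ j * (f j \<omega> - f (Suc j) \<omega>)\<^sup>2 \<partial>M) \<le> \<alpha> * (1 / 4) ^ j"
      by (simp only: quarter)
  qed simp
  then have conv: "AE \<omega> in M. convergent (\<lambda>j. f j \<omega>)"
    by eventually_elim (rule convergent_of_summable_increments)
  define V where "V \<omega> = lim (\<lambda>j. f j \<omega>)" for \<omega>
  have [measurable]: "V \<in> borel_measurable M" unfolding V_def by (rule borel_measurable_lim_metric) simp
  have V: "AE \<omega> in M. (\<lambda>j. f j \<omega>) \<longlonglongrightarrow> V \<omega>"
    using conv by eventually_elim (simp add: V_def convergent_LIMSEQ_iff)

  have "AE \<omega> in M. summable (\<lambda>j. (f j (S \<omega>) - f j \<omega>)\<^sup>2)"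
  proof (rule AE_summable_of_summable_integrals[OF _ _ _ sumq[of "2 * \<alpha>"]])
    fix j
    show "integrable M (\<lambda>\<omega>. (f j (S \<omega>) - f j \<omega>)\<^sup>2)"
      unfolding f_def using B pos by (intro second_moment_shift)
    have "(\<integral>\<omega>. (f j (S \<omega>) - f j \<omega>)\<^sup>2 \<partial>M) \<le> 2 * \<alpha> / measure \<mu> (B j)"
      unfolding f_def using B pos by (intro second_moment_shift)
    also have "\<dots> \<le> 2 * \<alpha> / 16 ^ j" using inv_le[of j] by simp
    also have "\<dots> \<le> 4 ^ j * (2 * \<alpha> / 16 ^ j)" 
      using mult_right_mono[of 1 "4 ^ j" "2 * \<alpha> / 16 ^ j"] \<alpha>0 by simp
    also have "\<dots> = 2 * \<alpha> * (1 / 4) ^ j" by (rule quarter)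
    finally show "(\<integral>\<omega>. (f j (S \<omega>) - f j \<omega>)\<^sup>2 \<partial>M) \<le> 2 * \<alpha> * (1 / 4) ^ j" .
  qed simp
  then have shift: "AE \<omega> in M. V (S \<omega>) = V \<omega>"
    using V AE_S[OF V]
  proof eventually_elim
    case (elim \<omega>)
    have "(\<lambda>j. (f j (S \<omega>) - f j \<omega>)\<^sup>2) \<longlonglongrightarrow> 0" by (rule summable_LIMSEQ_zero[OF elim(1)])
    moreover have "(\<lambda>j. (f j (S \<omega>) - f j \<omega>)\<^sup>2) \<longlonglongrightarrow> (V (S \<omega>) - V \<omega>)\<^sup>2"
      using elim(2,3) by (intro tendsto_intros)
    ultimately have "(V (S \<omega>) - V \<omega>)\<^sup>2 = 0" by (metis LIMSEQ_unique)
    then show ?case by simp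
  qed

  have nnV: "(\<integral>\<^sup>+\<omega>. ennreal ((f i \<omega> - V \<omega>)\<^sup>2) \<partial>M) \<le> ennreal (\<alpha> / 16 ^ i)" for i
  proof -
    have "(\<integral>\<^sup>+\<omega>. ennreal ((f i \<omega> - V \<omega>)\<^sup>2) \<partial>M) = (\<integral>\<^sup>+\<omega>. liminf (\<lambda>j. ennreal ((f i \<omega> - f j \<omega>)\<^sup>2)) \<partial>M)"
    proof (rule nn_integral_cong_AE)
      show "AE \<omega> in M. ennreal ((f i \<omega> - V \<omega>)\<^sup>2) = liminf (\<lambda>j. ennreal ((f i \<omega> - f j \<omega>)\<^sup>2))"
        using V
      proof eventually_elim
        case (elim \<omega>)
        have "(\<lambda>j. ennreal ((f i \<omega> - f j \<omega>)\<^sup>2)) \<longlonglongrightarrow> ennreal ((f i \<omega> - V \<omega>)\<^sup>2)"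
          by (intro tendsto_ennrealI tendsto_intros elim)
        then show ?case by (intro lim_imp_Liminf[symmetric]) auto
      qed
    qed
    also have "\<dots> \<le> liminf (\<lambda>j. \<integral>\<^sup>+\<omega>. ennreal ((f i \<omega> - f j \<omega>)\<^sup>2) \<partial>M)"
      by (rule nn_integral_liminf) measurable
    also have "\<dots> \<le> limsup (\<lambda>j. \<integral>\<^sup>+\<omega>. ennreal ((f i \<omega> - f j \<omega>)\<^sup>2) \<partial>M)"
      by (rule Liminf_le_Limsup) simp
    also have "\<dots> \<le> ennreal (\<alpha> / 16 ^ i)"
    proof (rule Limsup_bounded)
      show "\<forall>\<^sub>F j in sequentially. (\<integral>\<^sup>+\<omega>. ennreal ((f i \<omega> - f j \<omega>)\<^sup>2) \<partial>M) \<le> ennreal (\<alpha> / 16 ^ i)"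
        using eventually_ge_at_top[of i]
      proof eventually_elim
        case (elim j)
        have "(\<integral>\<^sup>+\<omega>. ennreal ((f i \<omega> - f j \<omega>)\<^sup>2) \<partial>M) = ennreal (\<integral>\<omega>. (f i \<omega> - f j \<omega>)\<^sup>2 \<partial>M)"
          by (intro nn_integral_eq_integral diff elim) simp
        then show ?case using diff(2)[OF elim] by (simp add: ennreal_leI)
      qed
    qed
    finally show ?thesis .
  qed
  have intV2: "integrable M (\<lambda>\<omega>. (f i \<omega> - V \<omega>)\<^sup>2)" for i
  proof (rule integrableI_nonneg)
    show "(\<integral>\<^sup>+\<omega>. ennreal ((f i \<omega> - V \<omega>)\<^sup>2) \<partial>M) < \<infinity>"
      using nnV[of i] by (rule le_less_trans) simp
  qed auto
  have EV2: "(\<integral>\<omega>. (f i \<omega> - V \<omega>)\<^sup>2 \<partial>M) \<le> \<alpha> / 16 ^ i" for i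
  proof -
    have "ennreal (\<integral>\<omega>. (f i \<omega> - V \<omega>)\<^sup>2 \<partial>M) = (\<integral>\<^sup>+\<omega>. ennreal ((f i \<omega> - V \<omega>)\<^sup>2) \<partial>M)"
      by (rule nn_integral_eq_integral[symmetric]) (use intV2 in auto)
    then have "ennreal (\<integral>\<omega>. (f i \<omega> - V \<omega>)\<^sup>2 \<partial>M) \<le> ennreal (\<alpha> / 16 ^ i)"
      using nnV[of i] by (simp only:)
    then show ?thesis by (rule ennreal_le_iff[THEN iffD1, rotated]) (use \<alpha>0 in simp)
  qed
  \<comment> \<open>Mean square bounds become bounds for the mean absolute difference, with a weight that still decays.\<close>
  have le_sq: "\<bar>x\<bar> \<le> (1 / 4) ^ j + 4 ^ j * x\<^sup>2" for x :: real and j :: nat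
    using abs_mult_le_weighted_squares[of 1 x j] by (simp add: power_divide)
  have intd: "integrable M (\<lambda>\<omega>. f i \<omega> - V \<omega>)" for i
  proof (rule Bochner_Integration.integrable_bound)
    show "integrable M (\<lambda>\<omega>. (1 / 4) ^ 0 + 4 ^ 0 * (f i \<omega> - V \<omega>)\<^sup>2)"
      by (intro Bochner_Integration.integrable_add integrable_mult_right intV2) simp
    show "AE \<omega> in M. norm (f i \<omega> - V \<omega>) \<le> norm ((1 / 4) ^ 0 + 4 ^ 0 * (f i \<omega> - V \<omega>)\<^sup>2)"
      using le_sq[of _ 0] by (auto intro: order_trans[OF _ abs_ge_self])
  qed measurable
  have intV: "integrable M V"
    using Bochner_Integration.integrable_diff[OF mean(1)[of 0] intd[of 0]] by simp
  have EV: "(\<integral>\<omega>. V \<omega> \<partial>M) = \<alpha>"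
  proof -
    have "\<bar>\<alpha> - (\<integral>\<omega>. V \<omega> \<partial>M)\<bar> \<le> (1 + \<alpha>) / 4 ^ j" for j
    proof -
      have "\<alpha> - (\<integral>\<omega>. V \<omega> \<partial>M) = (\<integral>\<omega>. f j \<omega> - V \<omega> \<partial>M)"
        using mean[of j] intV by simp
      also have "\<bar>\<dots>\<bar> \<le> (\<integral>\<omega>. \<bar>f j \<omega> - V \<omega>\<bar> \<partial>M)" by (rule integral_abs_bound)
      also have "\<dots> \<le> (\<integral>\<omega>. (1 / 4) ^ j + 4 ^ j * (f j \<omega> - V \<omega>)\<^sup>2 \<partial>M)"
        by (intro integral_mono le_sq integrable_abs intd Bochner_Integration.integrable_add
            integrable_mult_right intV2) simp
      also have "\<dots> = (1 / 4) ^ j + 4 ^ j * (\<integral>\<omega>. (f j \<omega> - V \<omega>)\<^sup>2 \<partial>M)"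
        using intV2[of j] prob_space by simp
      also have "\<dots> \<le> (1 / 4) ^ j + 4 ^ j * (\<alpha> / 16 ^ j)"
        using EV2[of j] by (intro add_left_mono mult_left_mono) auto
      also have "\<dots> = (1 + \<alpha>) / 4 ^ j" unfolding quarter by (simp add: power_divide add_divide_distrib)
      finally show ?thesis .
    qed
    then have "\<alpha> - (\<integral>\<omega>. V \<omega> \<partial>M) = 0" by (rule eq_zero_of_geometric_bound)
    then show ?thesis by simp
  qed
  have V_const: "AE \<omega> in M. V \<omega> = \<alpha>"
  proof -
    define C where "C = {\<omega> \<in> space M. \<alpha> < V \<omega>}"
    have [measurable]: "C \<in> sets M" unfolding C_def by measurable
    \<comment> \<open>Either \<open>V - \<alpha>\<close> or \<open>\<alpha> - V\<close> is almost surely nonnegative; having mean zero, it then vanishes.\<close>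
    have "AE \<omega> in M. S \<omega> \<in> C \<longleftrightarrow> \<omega> \<in> C"
      using shift AE_space by eventually_elim (auto simp: C_def measurable_space[OF measurable_S])
    then have "(AE \<omega> in M. \<omega> \<in> C) \<or> (AE \<omega> in M. \<omega> \<notin> C)"
      by (intro almost_invariant_set_trivial[OF prob_space_axioms measurable_S distr_S ergodic_S]) auto
    moreover have "AE \<omega> in M. V \<omega> = \<alpha>" if le: "AE \<omega> in M. 0 \<le> s * (V \<omega> - \<alpha>)" and s: "s \<noteq> 0" for s
    proof -
      have "(\<integral>\<omega>. s * (V \<omega> - \<alpha>) \<partial>M) = 0" using intV EV prob_space by simp
      moreover have "integrable M (\<lambda>\<omega>. s * (V \<omega> - \<alpha>))" using intV by simp
      ultimately have "AE \<omega> in M. s * (V \<omega> - \<alpha>) = 0"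
        using integral_nonneg_eq_0_iff_AE[OF _ le] by blast
      then show ?thesis by eventually_elim (use s in simp)
    qed
    ultimately show ?thesis
    proof (elim disjE)
      assume *: "AE \<omega> in M. \<omega> \<in> C" and th: "\<And>s. AE \<omega> in M. 0 \<le> s * (V \<omega> - \<alpha>) \<Longrightarrow> s \<noteq> 0 \<Longrightarrow> AE \<omega> in M. V \<omega> = \<alpha>"
      show ?thesis by (rule th[of 1]) (use * in \<open>auto simp: C_def elim: eventually_mono\<close>)
    next
      assume *: "AE \<omega> in M. \<omega> \<notin> C" and th: "\<And>s. AE \<omega> in M. 0 \<le> s * (V \<omega> - \<alpha>) \<Longrightarrow> s \<noteq> 0 \<Longrightarrow> AE \<omega> in M. V \<omega> = \<alpha>"
      have "AE \<omega> in M. 0 \<le> (- 1) * (V \<omega> - \<alpha>)"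
        using * AE_space by eventually_elim (auto simp: C_def)
      then show ?thesis by (rule th) simp
    qed
  qed
  have AEc: "AE \<omega> in M. (f j \<omega> - V \<omega>)\<^sup>2 = (real (points (B j) \<omega>) / measure \<mu> (B j) - \<alpha>)\<^sup>2" for j
    using V_const by eventually_elim (simp add: f_def)
  have [measurable]: "points (B j) \<in> measurable M (count_space UNIV)" for j by (rule measurable_points[OF B(1)])
  show "integrable M (\<lambda>\<omega>. (real (points (B j) \<omega>) / measure \<mu> (B j) - \<alpha>)\<^sup>2)"
    by (rule integrable_cong_AE[THEN iffD1, OF _ _ AEc intV2]) measurable
  show "(\<integral>\<omega>. (real (points (B j) \<omega>) / measure \<mu> (B j) - \<alpha>)\<^sup>2 \<partial>M) \<le> \<alpha> / 16 ^ j"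
    using EV2[of j] integral_cong_AE[OF _ _ AEc[of j]] by simp
qed

text \<open>For \<open>B j\<close> disjoint from the reference set \<open>Q\<close>, the mean of \<open>F * points (B j) / \<mu>(B j)\<close>, where \<open>F\<close> is the
\<open>n\<close>-th falling factorial of \<open>points Q\<close>, equals \<open>c\<^sub>n\<^sub>+\<^sub>1 \<mu>(Q)\<^sup>n\<close> for every \<open>j\<close>; by the law of large numbers it tends
to \<open>\<alpha>\<close> times the mean of \<open>F\<close>, because \<open>F\<close> is square integrable.\<close>

lemma moment_constant_Suc: "moment_constant (Suc n) = \<alpha> * moment_constant n"
proof -
  let ?Q = reference_set
  let ?q = "measure \<mu> ?Q ^ n"
  have q: "0 < ?q" using reference_set_pos by simp
  obtain B :: "nat \<Rightarrow> 'a set" where inc: "incseq B"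
    and B: "\<And>j. B j \<in> sets borel" "\<And>j. emeasure \<mu> (B j) < \<infinity>"
    and large: "\<And>j. 16 ^ j \<le> measure \<mu> (B j)" and disj: "\<And>j. B j \<inter> ?Q = {}"
    using exists_growing_sets[OF reference_set reference_set_finite] by blast
  define F where "F \<omega> = real (fact n * (points ?Q \<omega> choose n))" for \<omega>
  have [measurable]: "points ?Q \<in> measurable M (count_space UNIV)" "points (B j) \<in> measurable M (count_space UNIV)" for j
    using B by (auto intro!: measurable_points)
  have [measurable]: "F \<in> borel_measurable M" unfolding F_def by measurable
  have F: "integrable M F" "(\<integral>\<omega>. F \<omega> \<partial>M) = moment_constant n * ?q"
    using factorial_moments[of "{()}" "\<lambda>_. ?Q" "\<lambda>_. n"] reference_set_finite
    by (auto simp: F_def[abs_def] disjoint_family_on_def has_bochner_integral_iff)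
  have F2: "integrable M (\<lambda>\<omega>. (F \<omega>)\<^sup>2)"
  proof (rule integrableI_nonneg)
    have "(\<integral>\<^sup>+\<omega>. ennreal ((F \<omega>)\<^sup>2) \<partial>M) \<le> (\<integral>\<^sup>+\<omega>. num_points (N \<omega>) ?Q ^ (n * 2) \<partial>M)"
    proof (rule nn_integral_mono_AE)
      show "AE \<omega> in M. ennreal ((F \<omega>)\<^sup>2) \<le> num_points (N \<omega>) ?Q ^ (n * 2)"
        using AE_num_points_eq[OF reference_set reference_set_finite]
      proof eventually_elim
        case (elim \<omega>)
        have "F \<omega> \<le> real (points ?Q \<omega> ^ n)"
          unfolding F_def using binomial_fact_pow[of "points ?Q \<omega>" n] by (simp only: of_nat_le_iff mult.commute)
        then have "(F \<omega>)\<^sup>2 \<le> real (points ?Q \<omega> ^ n) ^ 2" by (intro power_mono) (auto simp: F_def)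
        also have "\<dots> = real (points ?Q \<omega>) ^ (n * 2)" by (simp flip: power_mult)
        finally show ?case
          unfolding elim by (simp add: ennreal_of_nat_eq_real_of_nat ennreal_power ennreal_leI)
      qed
    qed
    also have "\<dots> < \<infinity>" by (rule moment_finite[OF reference_set reference_set_finite])
    finally show "(\<integral>\<^sup>+\<omega>. ennreal ((F \<omega>)\<^sup>2) \<partial>M) < \<infinity>" .
  qed auto
  let ?x = "moment_constant (Suc n) * ?q - \<alpha> * (moment_constant n * ?q)"
  have "\<bar>?x\<bar> \<le> ((\<integral>\<omega>. (F \<omega>)\<^sup>2 \<partial>M) + \<alpha>) / 4 ^ j" for j
  proof -
    let ?b = "measure \<mu> (B j)"
    define u where "u \<omega> = real (points (B j) \<omega>) / ?b - \<alpha>" for \<omega>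
    have [measurable]: "u \<in> borel_measurable M" unfolding u_def by measurable
    have u: "integrable M (\<lambda>\<omega>. (u \<omega>)\<^sup>2)" "(\<integral>\<omega>. (u \<omega>)\<^sup>2 \<partial>M) \<le> \<alpha> / 16 ^ j"
      unfolding u_def using law_of_large_numbers[OF inc B large, of j] by auto
    have b: "0 < ?b" using large[of j] by (rule less_le_trans[rotated]) simp
    have dF: "disjoint_family_on (\<lambda>c. if c then ?Q else B j) {True, False}"
      using disj[of j] by (auto simp: disjoint_family_on_def)
    have "has_bochner_integral M (\<lambda>\<omega>. F \<omega> * real (points (B j) \<omega>)) (moment_constant (Suc n) * (?q * ?b))"
      using factorial_moments[OF _ _ _ dF, of "\<lambda>c. if c then n else 1"] B reference_set_finite
      by (simp add: F_def[abs_def] One_nat_def)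
    then have "has_bochner_integral M (\<lambda>\<omega>. F \<omega> * real (points (B j) \<omega>) / ?b) (moment_constant (Suc n) * (?q * ?b) / ?b)"
      by (rule has_bochner_integral_divide)
    then have FX: "has_bochner_integral M (\<lambda>\<omega>. F \<omega> * real (points (B j) \<omega>) / ?b) (moment_constant (Suc n) * ?q)"
      using b by simp
    have "has_bochner_integral M (\<lambda>\<omega>. \<alpha> * F \<omega>) (\<alpha> * (moment_constant n * ?q))"
      using F by (intro has_bochner_integral_mult_right) (simp add: has_bochner_integral_iff)
    with FX have "has_bochner_integral M (\<lambda>\<omega>. F \<omega> * real (points (B j) \<omega>) / ?b - \<alpha> * F \<omega>) ?x"
      by (rule has_bochner_integral_diff)
    moreover have "(\<lambda>\<omega>. F \<omega> * real (points (B j) \<omega>) / ?b - \<alpha> * F \<omega>) = (\<lambda>\<omega>. F \<omega> * u \<omega>)"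
      by (simp add: fun_eq_iff u_def right_diff_distrib)
    ultimately have Fu: "has_bochner_integral M (\<lambda>\<omega>. F \<omega> * u \<omega>) ?x" by (simp only:)
    then have "\<bar>?x\<bar> = \<bar>\<integral>\<omega>. F \<omega> * u \<omega> \<partial>M\<bar>" by (simp only: has_bochner_integral_integral_eq)
    also have "\<dots> \<le> (\<integral>\<omega>. \<bar>F \<omega> * u \<omega>\<bar> \<partial>M)" by (rule integral_abs_bound)
    also have "\<dots> \<le> (\<integral>\<omega>. (F \<omega>)\<^sup>2 / 4 ^ j + 4 ^ j * (u \<omega>)\<^sup>2 \<partial>M)"
      using Fu by (intro integral_mono abs_mult_le_weighted_squares integrable_abs Bochner_Integration.integrable_add
         integrable_divide integrable_mult_right F2 u) (simp add: has_bochner_integral_iff)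
    also have "\<dots> = (\<integral>\<omega>. (F \<omega>)\<^sup>2 \<partial>M) / 4 ^ j + 4 ^ j * (\<integral>\<omega>. (u \<omega>)\<^sup>2 \<partial>M)"
      using F2 u by simp
    also have "\<dots> \<le> (\<integral>\<omega>. (F \<omega>)\<^sup>2 \<partial>M) / 4 ^ j + 4 ^ j * (\<alpha> / 16 ^ j)"
      using u(2) by (intro add_left_mono mult_left_mono) auto
    also have "4 ^ j * (\<alpha> / 16 ^ j) = \<alpha> / 4 ^ j"
    proof -
      have "(16::real) ^ j = 4 ^ j * 4 ^ j" by (simp flip: power_mult_distrib)
      then show ?thesis by simp
    qed
    finally show ?thesis by (simp add: add_divide_distrib)
  qed
  then have "?x = 0" by (rule eq_zero_of_geometric_bound)
  then have "moment_constant (Suc n) * ?q = (\<alpha> * moment_constant n) * ?q" by simp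
  then show ?thesis using reference_set_pos by simp
qed

lemma moment_constant_eq_power: "moment_constant n = \<alpha> ^ n"
proof (induction n)
  case 0
  show ?case by (simp add: moment_constant_0)
next
  case (Suc n)
  then show ?case by (subst moment_constant_Suc) simp
qed

end

section \<open>The joint law of the counts\<close>

context free_point_process
begin

text \<open>Starting from the factorial moments, the induction turns one falling factorial after another into an indicator.
The product of all other factors serves as the weight in \<open>poisson_law_from_factorial_moments\<close>; its exponents
are arbitrary in the induction hypothesis, so that the exponent of the variable treated next can vary.\<close>

lemma mixed_moments:
  fixes A :: "'i \<Rightarrow> 'a set"
  assumes I: "finite I" and A: "\<And>i. i \<in> I \<Longrightarrow> A i \<in> sets borel" "\<And>i. i \<in> I \<Longrightarrow> emeasure \<mu> (A i) < \<infinity>"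
    and disj: "disjoint_family_on A I" and J: "J \<subseteq> I"
  shows "has_bochner_integral M
     (\<lambda>\<omega>. (\<Prod>i\<in>J. indicator (B i) (points (A i) \<omega>)) * (\<Prod>i\<in>I - J. real (fact (e i) * (points (A i) \<omega> choose e i))))
     ((\<Prod>i\<in>J. poisson_mass (\<alpha> * measure \<mu> (A i)) (B i)) * (\<Prod>i\<in>I - J. (\<alpha> * measure \<mu> (A i)) ^ e i))"
  using finite_subset[OF J I] J
proof (induction J arbitrary: e)
  case empty
  have "moment_constant (sum e I) * (\<Prod>i\<in>I. measure \<mu> (A i) ^ e i) = (\<Prod>i\<in>I. (\<alpha> * measure \<mu> (A i)) ^ e i)"
    using I by (simp only: moment_constant_eq_power[of "sum e I"] power_sum power_mult_distrib prod.distrib)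
  then show ?case using factorial_moments[OF I A disj, of e] by simp
next
  case (insert a J)
  have a: "a \<in> I" "a \<notin> J" and JI: "J \<subseteq> I" using insert by auto
  let ?K = "I - insert a J"
  have K: "I - J = insert a ?K" "a \<notin> ?K" "finite ?K" using a I by auto
  let ?l = "\<alpha> * measure \<mu> (A a)"
  let ?p = "\<Prod>i\<in>J. poisson_mass (\<alpha> * measure \<mu> (A i)) (B i)"
  let ?r = "\<Prod>i\<in>?K. (\<alpha> * measure \<mu> (A i)) ^ e i"
  define Y where "Y \<omega> = (\<Prod>i\<in>J. indicator (B i) (points (A i) \<omega>)) *
      (\<Prod>i\<in>?K. real (fact (e i) * (points (A i) \<omega> choose e i)))" for \<omega>
  have Y0: "0 \<le> Y \<omega>" for \<omega>
    unfolding Y_def by (intro mult_nonneg_nonneg prod_nonneg) auto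
  have step: "has_bochner_integral M (\<lambda>\<omega>. Y \<omega> * real (fact m * (points (A a) \<omega> choose m))) (?p * ?r * ?l ^ m)" for m
  proof -
    have eqK: "(\<Prod>i\<in>?K. real (fact ((e(a := m)) i) * (points (A i) \<omega> choose (e(a := m)) i))) =
        (\<Prod>i\<in>?K. real (fact (e i) * (points (A i) \<omega> choose e i)))" for \<omega>
      by (rule prod.cong) auto
    have eqr: "(\<Prod>i\<in>?K. (\<alpha> * measure \<mu> (A i)) ^ (e(a := m)) i) = ?r" by (rule prod.cong) auto
    show ?thesis
      using insert.IH[OF JI, of "e(a := m)"]
      unfolding K(1) prod.insert[OF K(3,2)] eqK eqr Y_def by (simp only: fun_upd_same mult_ac)
  qed
  have [measurable]: "points (A a) \<in> measurable M (count_space UNIV)" using a A by (intro measurable_points)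
  have "(\<integral>\<omega>. Y \<omega> * indicator (B a) (points (A a) \<omega>) \<partial>M) = ?p * ?r * poisson_mass ?l (B a)"
    by (rule poisson_law_from_factorial_moments)
       (use Y0 step in \<open>auto simp: has_bochner_integral_iff intro!: mult_nonneg_nonneg moment_constant_nonneg\<close>)
  moreover have "integrable M (\<lambda>\<omega>. Y \<omega> * indicator (B a) (points (A a) \<omega>))"
  proof (rule Bochner_Integration.integrable_bound)
    show i: "integrable M Y" using step[of 0] by (simp add: has_bochner_integral_iff)
    then have [measurable]: "Y \<in> borel_measurable M" by (rule borel_measurable_integrable)
    show "(\<lambda>\<omega>. Y \<omega> * indicator (B a) (points (A a) \<omega>)) \<in> borel_measurable M" by measurable
    show "AE \<omega> in M. norm (Y \<omega> * indicator (B a) (points (A a) \<omega>)) \<le> norm (Y \<omega>)"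
      by (auto simp: indicator_def)
  qed
  ultimately have "has_bochner_integral M (\<lambda>\<omega>. Y \<omega> * indicator (B a) (points (A a) \<omega>)) (?p * ?r * poisson_mass ?l (B a))"
    by (simp only: has_bochner_integral_iff)
  then show ?case
    unfolding Y_def prod.insert[OF insert.hyps] by (simp only: mult_ac)
qed

lemma joint_law:
  fixes A :: "'i \<Rightarrow> 'a set"
  assumes I: "finite I" and A: "\<And>i. i \<in> I \<Longrightarrow> A i \<in> sets borel" "\<And>i. i \<in> I \<Longrightarrow> emeasure \<mu> (A i) < \<infinity>"
    and disj: "disjoint_family_on A I" and B: "\<And>i. i \<in> I \<Longrightarrow> B i \<in> sets borel"
  shows "prob {\<omega> \<in> space M. \<forall>i\<in>I. num_points (N \<omega>) (A i) \<in> B i} =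
    (\<Prod>i\<in>I. poisson_mass (\<alpha> * measure \<mu> (A i)) {j. of_nat j \<in> B i})"
proof -
  let ?B = "\<lambda>i. {j. of_nat j \<in> B i}"
  let ?E = "{\<omega> \<in> space M. \<forall>i\<in>I. points (A i) \<omega> \<in> ?B i}"
  let ?F = "{\<omega> \<in> space M. \<forall>i\<in>I. num_points (N \<omega>) (A i) \<in> B i}"
  have E: "?E \<in> events"
  proof (rule sets.sets_Collect_finite_All[OF _ I])
    fix i assume "i \<in> I"
    then have [measurable]: "points (A i) \<in> measurable M (count_space UNIV)" using A by (intro measurable_points)
    show "{\<omega> \<in> space M. points (A i) \<omega> \<in> ?B i} \<in> events" by measurable
  qed
  have F: "?F \<in> events"
  proof (rule sets.sets_Collect_finite_All[OF _ I])
    fix i assume i: "i \<in> I"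
    show "{\<omega> \<in> space M. num_points (N \<omega>) (A i) \<in> B i} \<in> events"
      using measurable_sets[OF measurable_num_points[OF A(1)[OF i]] B[OF i]]
      by (simp add: vimage_def Int_def conj_commute)
  qed
  have "AE \<omega> in M. \<forall>i\<in>I. num_points (N \<omega>) (A i) = of_nat (points (A i) \<omega>)"
    using AE_num_points_eq A I by (simp add: AE_finite_all)
  then have "AE \<omega> in M. \<omega> \<in> ?F \<longleftrightarrow> \<omega> \<in> ?E" by eventually_elim simp
  then have "prob ?F = prob ?E" using E F by (intro measure_eq_AE)
  also have "\<dots> = (\<integral>\<omega>. indicator ?E \<omega> \<partial>M)" using E by simp
  also have "\<dots> = (\<integral>\<omega>. (\<Prod>i\<in>I. indicator (?B i) (points (A i) \<omega>)) \<partial>M)"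
  proof (rule Bochner_Integration.integral_cong[OF refl])
    fix \<omega> assume w: "\<omega> \<in> space M"
    show "(indicator ?E \<omega> :: real) = (\<Prod>i\<in>I. indicator (?B i) (points (A i) \<omega>))"
    proof (cases "\<omega> \<in> ?E")
      case False
      then obtain i where "i \<in> I" "points (A i) \<omega> \<notin> ?B i" using w by auto
      then have "(\<Prod>i\<in>I. indicator (?B i) (points (A i) \<omega>)) = (0::real)"
        by (intro prod_zero[OF I]) (auto intro!: bexI[of _ i])
      then show ?thesis using False by simp
    qed simp
  qed
  also have "\<dots> = (\<Prod>i\<in>I. poisson_mass (\<alpha> * measure \<mu> (A i)) (?B i))"
    using mixed_moments[OF I A disj subset_refl, of ?B "\<lambda>_. 0"] by (simp add: has_bochner_integral_iff)
  finally show ?thesis .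
qed

lemma counts_independent:
  fixes A :: "'i \<Rightarrow> 'a set"
  assumes A: "\<And>i. i \<in> I \<Longrightarrow> A i \<in> sets borel" "\<And>i. i \<in> I \<Longrightarrow> emeasure \<mu> (A i) < \<infinity>"
    and disj: "disjoint_family_on A I"
  shows "indep_vars (\<lambda>_. borel) (\<lambda>i \<omega>. num_points (N \<omega>) (A i)) I"
  unfolding indep_vars_def2
proof (intro conjI ballI indep_setsI)
  fix i assume i: "i \<in> I"
  show rv: "random_variable borel (\<lambda>\<omega>. num_points (N \<omega>) (A i))" by (rule measurable_num_points[OF A(1)[OF i]])
  show "{(\<lambda>\<omega>. num_points (N \<omega>) (A i)) -` B \<inter> space M |B. B \<in> sets borel} \<subseteq> events"
    using measurable_sets[OF rv] by auto
next
  fix E J assume J: "J \<noteq> {}" "J \<subseteq> I" "finite J"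
    and E: "\<forall>j\<in>J. E j \<in> {(\<lambda>\<omega>. num_points (N \<omega>) (A j)) -` B \<inter> space M |B. B \<in> sets borel}"
  then have "\<forall>j\<in>J. \<exists>B. B \<in> sets borel \<and> E j = (\<lambda>\<omega>. num_points (N \<omega>) (A j)) -` B \<inter> space M" by blast
  then obtain B where B: "\<And>j. j \<in> J \<Longrightarrow> B j \<in> sets borel"
    and EB: "\<And>j. j \<in> J \<Longrightarrow> E j = (\<lambda>\<omega>. num_points (N \<omega>) (A j)) -` B j \<inter> space M" by metis
  have AJ: "\<And>i. i \<in> J \<Longrightarrow> A i \<in> sets borel" "\<And>i. i \<in> J \<Longrightarrow> emeasure \<mu> (A i) < \<infinity>"
    "disjoint_family_on A J"
    using A J disj by (auto intro: disjoint_family_on_mono)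
  have "(\<Inter>j\<in>J. E j) = {\<omega> \<in> space M. \<forall>i\<in>J. num_points (N \<omega>) (A i) \<in> B i}"
    using J(1) by (auto simp: EB)
  then have "prob (\<Inter>j\<in>J. E j) = (\<Prod>j\<in>J. poisson_mass (\<alpha> * measure \<mu> (A j)) {n. of_nat n \<in> B j})"
    using joint_law[OF J(3) AJ B] by simp
  also have "\<dots> = (\<Prod>j\<in>J. prob (E j))"
  proof (rule prod.cong[OF refl])
    fix j assume j: "j \<in> J"
    have "E j = {\<omega> \<in> space M. \<forall>i\<in>{j}. num_points (N \<omega>) (A i) \<in> B i}" using EB[OF j] by auto
    then show "poisson_mass (\<alpha> * measure \<mu> (A j)) {n. of_nat n \<in> B j} = prob (E j)"
      using joint_law[of "{j}" A B] AJ B j by (simp add: disjoint_family_on_def)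
  qed
  finally show "prob (\<Inter>j\<in>J. E j) = (\<Prod>j\<in>J. prob (E j))" .
qed

lemma count_poisson:
  assumes "A \<in> sets borel" "emeasure \<mu> A < \<infinity>"
  shows "prob {\<omega> \<in> space M. num_points (N \<omega>) A = of_nat j} =
    (\<alpha> * measure \<mu> A) ^ j / fact j * exp (- (\<alpha> * measure \<mu> A))"
  using joint_law[of "{()}" "\<lambda>_. A" "\<lambda>_. {of_nat j}"] assms
  by (simp add: disjoint_family_on_def poisson_mass_singleton)

lemma intensity:
  assumes A: "A \<in> sets borel"
  shows "(\<integral>\<^sup>+\<omega>. num_points (N \<omega>) A \<partial>M) = ennreal \<alpha> * emeasure \<mu> A"
proof -
  let ?R = "Pi\<^sub>E {1..1} (\<lambda>_. A) :: (nat \<Rightarrow> 'a) set"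
  have "tuples 1 \<omega> (?R \<inter> distinct_tuples 1) = num_points (N \<omega>) A" for \<omega>
  proof -
    have "bij_betw (\<lambda>y. \<lambda>i\<in>{1..1}. y) (N \<omega> \<inter> A) (Pi\<^sub>E {1..1::nat} (\<lambda>_. N \<omega>) \<inter> (?R \<inter> distinct_tuples 1))"
      by (rule bij_betwI[where g = "\<lambda>x. x 1"])
         (auto simp: distinct_tuples_def space_PiM PiE_iff extensional_def fun_eq_iff)
    then show ?thesis unfolding tuples_def num_points_def by (rule emeasure_count_space_bij[symmetric])
  qed
  moreover have "?R \<in> sets (product_space 1)" using A by (auto intro!: sets_PiM_I_finite)
  ultimately have "(\<integral>\<^sup>+\<omega>. num_points (N \<omega>) A \<partial>M) = emeasure (factorial_moment_measure 1) ?R"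
    by (simp add: emeasure_factorial_moment_measure)
  also have "\<dots> = ennreal \<alpha> * emeasure \<mu> A"
    using factorial_moment_rectangle[of 1 "\<lambda>_. A"] A by simp
  finally show ?thesis .
qed

end

theorem theorem3p2:
  fixes \<mu> :: "'a::polish_space measure" and T :: "'a \<Rightarrow> 'a"
    and M :: "'w measure" and S :: "'w \<Rightarrow> 'w" and N :: "'w \<Rightarrow> 'a set"
  assumes "infinite_cons_ergodic_system \<mu> T"
    and "property_P1 \<mu> T"
    and "property_P2 \<mu> T"
    and "T_point_process \<mu> T M S N"
    and "ergodic M S"
    and "free_process M S N"
    and "moments_of_all_orders \<mu> M N"
  shows "\<exists>\<alpha>\<ge>0. poisson_process \<mu> \<alpha> M N \<and>
    (\<forall>A\<in>sets \<mu>. (\<integral>\<^sup>+\<omega>. num_points (N \<omega>) A \<partial>M) = ennreal \<alpha> * emeasure \<mu> A)"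
proof -
  interpret free_point_process \<mu> T M S N by unfold_locales fact+
  have "poisson_process \<mu> \<alpha> M N"
    unfolding poisson_process_def
  proof (intro allI impI conjI ballI; elim conjE)
    fix k :: nat and A :: "nat \<Rightarrow> 'a set" and i j :: nat
    assume "\<forall>i\<in>{1..k}. A i \<in> finite_pos_sets \<mu>" and disj: "disjoint_family_on A {1..k}"
    then have A: "A l \<in> sets borel" "emeasure \<mu> (A l) < \<infinity>" if "l \<in> {1..k}" for l
      using that by (auto simp: finite_pos_sets_def)
    show "indep_vars (\<lambda>_. borel) (\<lambda>i \<omega>. num_points (N \<omega>) (A i)) {1..k}"
      by (intro counts_independent A disj)
    show "prob {\<omega> \<in> space M. num_points (N \<omega>) (A i) = of_nat j} =
        (\<alpha> * measure \<mu> (A i)) ^ j / fact j * exp (- (\<alpha> * measure \<mu> (A i)))" if "i \<in> {1..k}"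
      by (intro count_poisson A that)
  qed
  then show ?thesis
    using intensity by (intro exI[of _ \<alpha>]) (simp add: moment_constant_nonneg)
qed

end
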